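(* Let $k\in\{1,2,\dots\}$, let $X_1,\dots,X_n$ be an i.i.d. sample from a $k$-monotone density on $(0,\infty)$ with empirical distribution function $\mathbb G_n$, and let $\tilde g_{n,k}\in\mathcal M_k\cap L_2(\lambda)$ with associated mixing measure $\tilde F_{n,k}$. Define $$\mathbb Y_{n,k}(t)=\int_0^t\int_0^{t_{k-1}}\cdots\int_0^{t_2}\mathbb G_n(t_1)\,dt_1\,dt_2\cdots dt_{k-1},\qquad t\ge0,$$ $$\tilde H_{n,k}(t)=\int_0^t\int_0^{t_k}\cdots\int_0^{t_2}\tilde g_{n,k}(t_1)\,dt_1\,dt_2\cdots dt_k,\qquad t\ge0.$$ Then $\tilde g_{n,k}$ is the least squares estimator over $\mathcal M_k\cap L_2(\lambda)$ if and only if $$\tilde H_{n,k}(t)\ge\mathbb Y_{n,k}(t)\ \text{ for all } t\ge0,\qquad\text{and}\qquad \tilde H_{n,k}(t)=\mathbb Y_{n,k}(t)\ \text{ for all } t\in\mathrm{supp}(\tilde F_{n,k}).$$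
   Context: For $k\ge2$, a function $g$ on $(0,\infty)$ is $k$-monotone if $(-1)^l g^{(l)}$ is nonnegative, nonincreasing and convex for $l=0,\dots,k-2$; for $k=1$, if it is nonnegative and nonincreasing. $\mathcal M_k$ is the class of $k$-monotone functions on $(0,\infty)$; $\lambda$ is Lebesgue measure on $(0,\infty)$. $\mathbb G_n(x)=n^{-1}\sum_{i=1}^n1\{X_i\le x\}$. The least squares estimator over $\mathcal M_k\cap L_2(\lambda)$ is the minimizer over $g\in\mathcal M_k\cap L_2(\lambda)$ of $Q_n(g)=\frac12\int_0^\infty g^2(x)\,dx-\int_0^\infty g(x)\,d\mathbb G_n(x)$. The mixing measure $F$ of $g\in\mathcal M_k\cap L_2(\lambda)$ is the nonnegative measure on $(0,\infty)$ with $g(x)=\int_0^\infty\frac{k(t-x)_+^{k-1}}{t^k}dF(t)$, $x>0$, where $y_+=\max(y,0)$. For $k=1$, $\mathbb Y_{n,1}=\mathbb G_n$. Equivalently, $\mathbb Y_{n,k}(t)=\int_0^t\frac{(t-x)^{k-1}}{(k-1)!}d\mathbb G_n(x)$ and $\tilde H_{n,k}(t)=\int_0^t\frac{(t-x)^{k-1}}{(k-1)!}\tilde g_{n,k}(x)dx$. *)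

theory Defs
  imports "HOL-Probability.Probability"
begin

text \<open>Functions on the open half-line are modelled as total functions \<open>real \<Rightarrow> real\<close> whose values
  on \<open>{..0}\<close> are never inspected.\<close>

definition lambda_pos :: "real measure" where
  "lambda_pos = restrict_space lborel {0<..}"

text \<open>Only meaningful for \<open>k \<ge> 1\<close>. For \<open>k \<ge> 2\<close> the first conjunct says that the derivatives of order
  up to \<open>k - 2\<close> exist, so that \<open>(deriv ^^ l) g\<close> really is the \<open>l\<close>-th derivative of \<open>g\<close> on
  \<open>{0<..}\<close>.\<close>

definition k_monotone :: "nat \<Rightarrow> (real \<Rightarrow> real) \<Rightarrow> bool" where
  "k_monotone k g \<longleftrightarrow>
     (if k = 1 then (\<forall>x>0. 0 \<le> g x) \<and> antimono_on {0<..} g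
      else (\<forall>l<k - 2. \<forall>x>0. (deriv ^^ l) g differentiable (at x)) \<and>
           (\<forall>l\<le>k - 2.
              (\<forall>x>0. 0 \<le> (-1) ^ l * (deriv ^^ l) g x) \<and>
              antimono_on {0<..} (\<lambda>x. (-1) ^ l * (deriv ^^ l) g x) \<and>
              convex_on {0<..} (\<lambda>x. (-1) ^ l * (deriv ^^ l) g x)))"

text \<open>Square-integrable functions, not identified up to null sets: the criterion below evaluates
  them at the observations.\<close>

definition L2_pos :: "(real \<Rightarrow> real) set" where
  "L2_pos = {g. g \<in> borel_measurable lambda_pos \<and> integrable lambda_pos (\<lambda>x. (g x)\<^sup>2)}"

definition kmon_L2 :: "nat \<Rightarrow> (real \<Rightarrow> real) set" where
  "kmon_L2 k = {g. k_monotone k g} \<inter> L2_pos"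

definition emp_cdf :: "nat \<Rightarrow> (nat \<Rightarrow> real) \<Rightarrow> real \<Rightarrow> real" where
  "emp_cdf n x t = (\<Sum>i = 1..n. indicator {..t} (x i)) / real n"

text \<open>The integral with respect to \<open>d(emp_cdf n x)\<close> is the Lebesgue--Stieltjes integral.\<close>

definition ls_criterion :: "nat \<Rightarrow> (nat \<Rightarrow> real) \<Rightarrow> (real \<Rightarrow> real) \<Rightarrow> real" where
  "ls_criterion n x g =
     (1 / 2) * (\<integral>u. (g u)\<^sup>2 \<partial>lambda_pos) - (LINT u:{0<..}|interval_measure (emp_cdf n x). g u)"

definition is_lse :: "nat \<Rightarrow> nat \<Rightarrow> (nat \<Rightarrow> real) \<Rightarrow> (real \<Rightarrow> real) \<Rightarrow> bool" where
  "is_lse k n x g \<longleftrightarrow> is_arg_min (ls_criterion n x) (\<lambda>h. h \<in> kmon_L2 k) g"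

text \<open>The truncated power \<open>y\<^sub>+ ^ m\<close>. It equals \<open>max y 0 ^ m\<close> for \<open>m \<ge> 1\<close>; for \<open>m = 0\<close> it is the
  indicator of \<open>y \<ge> 0\<close>, the convention under which 1-monotone mixtures are left-continuous, as
  the least squares estimator for \<open>k = 1\<close> (the Grenander estimator) is.\<close>

definition trunc_power :: "real \<Rightarrow> nat \<Rightarrow> real" where
  "trunc_power y m = (if 0 \<le> y then y ^ m else 0)"

text \<open>The mixing measure may have infinite total mass, since \<open>g\<close> need not be integrable. The
  nonnegative integral contains the requirement that the mixture be finite at every \<open>x > 0\<close>.\<close>

definition mixing_measure :: "nat \<Rightarrow> (real \<Rightarrow> real) \<Rightarrow> real measure \<Rightarrow> bool" where
  "mixing_measure k g F \<longleftrightarrow>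
     sets F = sets (restrict_space borel {0<..}) \<and>
     (\<forall>x>0. ennreal (g x) =
        (\<integral>\<^sup>+t. ennreal (real k * trunc_power (t - x) (k - 1) / t ^ k) \<partial>F))"

definition measure_supp :: "real measure \<Rightarrow> real set" where
  "measure_supp F =
     {t. 0 < t \<and> (\<forall>U. open U \<and> t \<in> U \<longrightarrow> emeasure F (U \<inter> {0<..}) > 0)}"

definition iter_integral :: "nat \<Rightarrow> (real \<Rightarrow> real) \<Rightarrow> real \<Rightarrow> real" where
  "iter_integral m f = ((\<lambda>h t. LBINT s:{0<..t}. h s) ^^ m) f"

definition Y_process :: "nat \<Rightarrow> nat \<Rightarrow> (nat \<Rightarrow> real) \<Rightarrow> real \<Rightarrow> real" where
  "Y_process k n x = iter_integral (k - 1) (emp_cdf n x)"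

definition H_process :: "nat \<Rightarrow> (real \<Rightarrow> real) \<Rightarrow> real \<Rightarrow> real" where
  "H_process k g = iter_integral k g"

end

theory Submission
  imports Defs
begin

text \<open>
  Write \<open>L g h\<close> for the difference between \<open>\<integral> g h\<close> and the sample mean of \<open>h\<close>. On the convex
  cone of square-integrable \<open>k\<close>-monotone functions the criterion is a convex quadratic, so
  \<open>g\<close> is a minimizer if and only if \<open>L g h \<ge> 0\<close> for every \<open>h\<close> in the cone and \<open>L g g = 0\<close>: the first
  condition comes from moving from \<open>g\<close> towards \<open>g + h\<close>, the second from shrinking \<open>g\<close>, and
  conversely the two give the minimum because the second-order term is a square
  (\<open>is_lse_iff_variational\<close>).

  By Cauchy's formula for repeated integration, \<open>H t - Y t = L g h\<close> for the truncated power
  \<open>h x = (t - x)\<^sub>+ ^ (k - 1) / (k - 1)!\<close>, which lies in the cone. Both conditions are therefore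
  statements about the sign of \<open>H - Y\<close>, once the functions that occur in them are written as
  superpositions of truncated powers.

  For the first condition every \<open>h\<close> in the cone has to be written that way. The \<open>(k - 1)\<close>-st
  derivative of \<open>h\<close>, one-sided in the last step and up to sign, is a nonincreasing function \<open>\<phi>\<close> that
  vanishes at infinity; its layer-cake decomposition \<open>\<phi> x = \<integral> 1{x \<le> T s} ds\<close>, where \<open>T s\<close> is the
  point at which \<open>\<phi>\<close> drops below the level \<open>s\<close>, turns into a decomposition of \<open>h\<close> into truncated powers after \<open>k - 1\<close> integrations
  from infinity (\<open>k_monotone_superposition\<close>). The levels \<open>s\<close> themselves
  parametrize the mixture, with Lebesgue measure as mixing measure. By Tonelli, \<open>H \<ge> Y\<close> gives \<open>L g h \<ge> 0\<close> (\<open>sample_mean_le_if_pairing_le\<close>).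

  For the second condition \<open>g\<close> itself is the mixture given by \<open>F\<close>, so that \<open>L g g\<close> is the integral
  of \<open>k! (H t - Y t) / t ^ k\<close> with respect to \<open>F\<close>. When \<open>H \<ge> Y\<close> it vanishes if and only if
  \<open>H = Y\<close> almost everywhere for \<open>F\<close>. As \<open>H\<close> is continuous and \<open>Y\<close> is upper semicontinuous (it
  has upward jumps when \<open>k = 1\<close>), the set where \<open>Y < H\<close> is open, and an open set is null for \<open>F\<close> if
  and only if it does not meet the support of \<open>F\<close> (\<open>square_integral_eq_sample_mean_iff\<close>).
\<close>

section \<open>Truncated powers\<close>

text \<open>Dividing by the factorial makes integration and differentiation shift the exponent without
  producing a constant.\<close>

definition dpow :: "nat \<Rightarrow> real \<Rightarrow> real" where
  "dpow m y = trunc_power y m / fact m"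

lemma trunc_power_nonneg [simp]: "0 \<le> trunc_power y m"
  by (simp add: trunc_power_def)

lemma dpow_nonneg [simp]: "0 \<le> dpow m y"
  by (simp add: dpow_def)

lemma dpow_neg: "y < 0 \<Longrightarrow> dpow m y = 0"
  by (simp add: dpow_def trunc_power_def)

lemma dpow_0: "dpow 0 y = (if 0 \<le> y then 1 else 0)"
  by (simp add: dpow_def trunc_power_def)

lemma measurable_dpow [measurable]: "dpow m \<in> borel_measurable borel"
  unfolding dpow_def trunc_power_def by measurable

lemma nn_integral_dpow_left:
  assumes "0 < x"
  shows "(\<integral>\<^sup>+s. ennreal (dpow m (s - x)) * indicator {0<..t} s \<partial>lborel) = ennreal (dpow (Suc m) (t - x))"
proof (cases "x \<le> t")
  case True
  have "(\<integral>\<^sup>+s. ennreal (dpow m (s - x)) * indicator {0<..t} s \<partial>lborel)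
      = (\<integral>\<^sup>+s. ennreal ((s - x) ^ m / fact m) * indicator {x..t} s \<partial>lborel)"
    using assms True by (intro nn_integral_cong) (auto simp: dpow_def trunc_power_def indicator_def)
  also have "\<dots> = ennreal ((t - x) ^ Suc m / fact (Suc m) - (x - x) ^ Suc m / fact (Suc m))"
  proof (rule nn_integral_FTC_Icc)
    fix s :: real show "((\<lambda>s. (s - x) ^ Suc m / fact (Suc m)) has_real_derivative (s - x) ^ m / fact m) (at s)"
      by (rule derivative_eq_intros refl | simp)+
  qed (use True in auto)
  finally show ?thesis using True by (simp add: dpow_def trunc_power_def)
next
  case False
  then have "(\<integral>\<^sup>+s. ennreal (dpow m (s - x)) * indicator {0<..t} s \<partial>lborel) = (\<integral>\<^sup>+s. 0 \<partial>(lborel::real measure))"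
    by (intro nn_integral_cong) (auto simp: dpow_neg indicator_def)
  with False show ?thesis by (simp add: dpow_neg)
qed

lemma nn_integral_dpow_right:
  "(\<integral>\<^sup>+y. ennreal (dpow m (t - y)) * indicator {x..} y \<partial>lborel) = ennreal (dpow (Suc m) (t - x))"
proof (cases "x \<le> t")
  case True
  have "(\<integral>\<^sup>+y. ennreal (dpow m (t - y)) * indicator {x..} y \<partial>lborel)
      = (\<integral>\<^sup>+y. ennreal ((t - y) ^ m / fact m) * indicator {x..t} y \<partial>lborel)"
    using True by (intro nn_integral_cong) (auto simp: dpow_def trunc_power_def indicator_def)
  also have "\<dots> = ennreal (- ((t - t) ^ Suc m / fact (Suc m)) - (- ((t - x) ^ Suc m / fact (Suc m))))"
  proof (rule nn_integral_FTC_Icc)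
    fix s :: real show "((\<lambda>s. - ((t - s) ^ Suc m / fact (Suc m))) has_real_derivative (t - s) ^ m / fact m) (at s)"
      by (rule derivative_eq_intros refl | simp)+
  qed (use True in auto)
  finally show ?thesis using True by (simp add: dpow_def trunc_power_def)
next
  case False
  then have "(\<integral>\<^sup>+y. ennreal (dpow m (t - y)) * indicator {x..} y \<partial>lborel) = (\<integral>\<^sup>+s. 0 \<partial>(lborel::real measure))"
    by (intro nn_integral_cong) (auto simp: dpow_neg indicator_def)
  with False show ?thesis by (simp add: dpow_neg)
qed

section \<open>Nonincreasing densities of nonincreasing functions\<close>

text \<open>Cut the interval into equal pieces of length \<open>\<delta>\<close>: the bounds on the pieces telescope to
  \<open>(\<phi> a - \<phi> b) * \<delta>\<close>, and \<open>\<delta>\<close> is arbitrarily small.\<close>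

lemma eq_if_increments_telescope:
  fixes E \<phi> :: "real \<Rightarrow> real"
  assumes "a \<le> b"
    and inc: "\<And>c d. a \<le> c \<Longrightarrow> c \<le> d \<Longrightarrow> d \<le> b \<Longrightarrow> \<bar>E d - E c\<bar> \<le> (\<phi> c - \<phi> d) * (d - c)"
  shows "E a = E b"
proof -
  have bound: "\<bar>E b - E a\<bar> \<le> (\<phi> a - \<phi> b) * (b - a) * inverse (real (Suc n))" for n
  proof -
    define \<delta> where "\<delta> = (b - a) / real (Suc n)"
    define p where "p j = a + real j * \<delta>" for j
    have \<delta>: "0 \<le> \<delta>" "real (Suc n) * \<delta> = b - a" using \<open>a \<le> b\<close> by (auto simp: \<delta>_def)
    have pl: "a \<le> p j" for j using \<delta>(1) by (simp add: p_def)
    have ends: "p 0 = a" "p (Suc n) = b" using \<delta>(2) by (auto simp: p_def)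
    have pu: "p j \<le> b" if "j \<le> Suc n" for j
    proof -
      have "real j * \<delta> \<le> real (Suc n) * \<delta>" using that \<delta>(1) by (intro mult_right_mono) auto
      then show ?thesis using \<delta>(2) by (simp add: p_def)
    qed
    have ps: "p (Suc j) - p j = \<delta>" for j by (simp add: p_def algebra_simps)
    have "\<bar>E b - E a\<bar> = \<bar>\<Sum>j<Suc n. E (p (Suc j)) - E (p j)\<bar>"
      by (subst sum_lessThan_telescope) (simp add: ends)
    also have "\<dots> \<le> (\<Sum>j<Suc n. \<bar>E (p (Suc j)) - E (p j)\<bar>)" by (rule sum_abs)
    also have "\<dots> \<le> (\<Sum>j<Suc n. (\<phi> (p j) - \<phi> (p (Suc j))) * \<delta>)"
    proof (rule sum_mono)
      fix j assume "j \<in> {..<Suc n}"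
      then have "\<bar>E (p (Suc j)) - E (p j)\<bar> \<le> (\<phi> (p j) - \<phi> (p (Suc j))) * (p (Suc j) - p j)"
        using ps[of j] \<delta>(1) by (intro inc pl pu) auto
      then show "\<bar>E (p (Suc j)) - E (p j)\<bar> \<le> (\<phi> (p j) - \<phi> (p (Suc j))) * \<delta>" by (simp add: ps)
    qed
    also have "\<dots> = (\<phi> a - \<phi> b) * \<delta>"
      using sum_lessThan_telescope'[of "\<lambda>j. \<phi> (p j)" "Suc n"]
      by (simp only: sum_distrib_right[symmetric] ends)
    finally show ?thesis by (simp add: \<delta>_def divide_inverse mult.assoc)
  qed
  have "(\<lambda>n. (\<phi> a - \<phi> b) * (b - a) * inverse (real (Suc n))) \<longlonglongrightarrow> (\<phi> a - \<phi> b) * (b - a) * 0"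
    by (intro tendsto_intros LIMSEQ_inverse_real_of_nat)
  then have "\<bar>E b - E a\<bar> \<le> 0"
    using bound by (intro LIMSEQ_le_const) auto
  then show ?thesis by simp
qed

text \<open>The chord slopes of \<open>w\<close> lie between the values of \<open>- \<phi>\<close> at the end points. This covers at
  once \<open>\<phi> = - w'\<close> for a differentiable convex \<open>w\<close> and a negated subgradient \<open>\<phi>\<close> of an arbitrary
  convex \<open>w\<close>, which stands in for the derivative in the last step of a \<open>k\<close>-monotone function.\<close>

definition decrement_density :: "(real \<Rightarrow> real) \<Rightarrow> (real \<Rightarrow> real) \<Rightarrow> bool" where
  "decrement_density w \<phi> \<longleftrightarrow>
     (\<forall>a b. 0 < a \<longrightarrow> a < b \<longrightarrow> \<phi> b * (b - a) \<le> w a - w b \<and> w a - w b \<le> \<phi> a * (b - a))"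

lemma decrement_density_antimono:
  assumes "decrement_density w \<phi>"
  shows "antimono_on {0<..} \<phi>"
proof (rule monotone_onI)
  fix a b :: real assume "a \<in> {0<..}" "b \<in> {0<..}" "a \<le> b"
  then show "\<phi> b \<le> \<phi> a"
  proof (cases "a = b")
    case False
    then have "a < b" "0 < a" using \<open>a \<in> {0<..}\<close> \<open>a \<le> b\<close> by auto
    then have "\<phi> b * (b - a) \<le> \<phi> a * (b - a)"
      using assms unfolding decrement_density_def by (meson order_trans)
    then show ?thesis using \<open>a < b\<close> by simp
  qed simp
qed

lemma decrement_density_tendsto_0:
  assumes dd: "decrement_density w \<phi>" and nn: "\<And>x. 0 < x \<Longrightarrow> 0 \<le> \<phi> x" and w: "(w \<longlongrightarrow> 0) at_top"
  shows "(\<phi> \<longlongrightarrow> 0) at_top"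
proof (rule tendsto_sandwich)
  show "\<forall>\<^sub>F x in at_top. 0 \<le> \<phi> x"
    using eventually_gt_at_top[of "0::real"] by eventually_elim (rule nn)
  show "\<forall>\<^sub>F x in at_top. \<phi> x \<le> w (x - 1) - w x"
    using eventually_gt_at_top[of "1::real"]
  proof eventually_elim
    case (elim x)
    then show ?case using dd[unfolded decrement_density_def, rule_format, of "x - 1" x] by simp
  qed
  have "filterlim (\<lambda>x::real. - 1 + x) at_top at_top"
    by (rule filterlim_tendsto_add_at_top[OF tendsto_const filterlim_ident])
  then have "((\<lambda>x. w (x - 1)) \<longlongrightarrow> 0) at_top"
    by (intro filterlim_compose[OF w]) simp
  then show "((\<lambda>x. w (x - 1) - w x) \<longlongrightarrow> 0) at_top" using tendsto_diff[OF _ w] by fastforce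
qed simp

lemma antimono_integrable_on:
  fixes \<phi> :: "real \<Rightarrow> real"
  assumes "antimono_on {0<..} \<phi>" "0 < a"
  shows "\<phi> integrable_on {a..b}"
proof -
  have "mono_on {a..b} (\<lambda>x. - \<phi> x)"
    using assms by (auto simp: monotone_on_def)
  then have "(\<lambda>x. - \<phi> x) integrable_on {a..b}" by (rule integrable_on_mono_on)
  then show ?thesis using integrable_neg by fastforce
qed

text \<open>Both \<open>w a - w b\<close> and the integral of \<open>\<phi>\<close> over \<open>{a..b}\<close> lie between \<open>\<phi> b * (b - a)\<close> and
  \<open>\<phi> a * (b - a)\<close>, so the increments of \<open>w\<close> plus the indefinite integral obey the bound of
  \<open>eq_if_increments_telescope\<close>.\<close>

lemma decrement_density_has_integral:
  assumes dd: "decrement_density w \<phi>" and ab: "0 < a" "a \<le> b"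
  shows "(\<phi> has_integral (w a - w b)) {a..b}"
proof -
  note anti = decrement_density_antimono[OF dd]
  note int = antimono_integrable_on[OF anti]
  define E where "E t = w t + integral {a..t} \<phi>" for t
  have "E a = E b"
  proof (rule eq_if_increments_telescope[where E = E and \<phi> = \<phi>])
    fix c d assume cd: "a \<le> c" "c \<le> d" "d \<le> b"
    show "\<bar>E d - E c\<bar> \<le> (\<phi> c - \<phi> d) * (d - c)"
    proof (cases "c = d")
      case False
      then have "c < d" "0 < c" using cd ab by auto
      then have 1: "\<phi> d * (d - c) \<le> w c - w d" "w c - w d \<le> \<phi> c * (d - c)"
        using dd unfolding decrement_density_def by auto
      have "integral {a..d} \<phi> = integral {a..c} \<phi> + integral {c..d} \<phi>"
        using cd ab by (intro Henstock_Kurzweil_Integration.integral_combine[symmetric] int) auto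
      moreover have "integral {c..d} \<phi> \<le> integral {c..d} (\<lambda>_. \<phi> c)"
        using \<open>0 < c\<close> anti by (intro integral_le int) (auto simp: monotone_on_def)
      moreover have "integral {c..d} (\<lambda>_. \<phi> d) \<le> integral {c..d} \<phi>"
        using \<open>0 < c\<close> anti by (intro integral_le int) (auto simp: monotone_on_def)
      ultimately show ?thesis using 1 \<open>c < d\<close>
        unfolding E_def by (auto simp: algebra_simps abs_le_iff)
    qed simp
  qed (use ab in auto)
  then have "integral {a..b} \<phi> = w a - w b" by (simp add: E_def)
  then show ?thesis using int[OF ab(1), of b] by (metis integrable_integral)
qed

text \<open>Monotone convergence along \<open>{x..x + i}\<close>.\<close>

lemma nn_integral_decrement_density:
  assumes dd: "decrement_density w \<phi>" and nn: "\<And>x. 0 < x \<Longrightarrow> 0 \<le> \<phi> x"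
    and w: "(w \<longlongrightarrow> 0) at_top" and x: "0 < x"
  shows "(\<integral>\<^sup>+y. ennreal (\<phi> y) * indicator {x..} y \<partial>lborel) = ennreal (w x)"
proof -
  have "mono_on {0<..} (\<lambda>y. - \<phi> y)"
    using decrement_density_antimono[OF dd] by (simp add: monotone_on_def)
  then have "(\<lambda>y. - \<phi> y) \<in> borel_measurable (restrict_space borel {0<..})"
    by (rule borel_measurable_mono_on_fnc)
  then have "(\<lambda>y. indicator {0<..} y *\<^sub>R (- \<phi> y)) \<in> borel_measurable borel"
    by (subst (asm) borel_measurable_restrict_space_iff) auto
  then have [measurable]: "(\<lambda>y. indicator {0<..} y * \<phi> y) \<in> borel_measurable borel" by simp
  have ind: "ennreal (\<phi> y) * indicator A y = ennreal (indicator {0<..} y * \<phi> y) * indicator A y" if "A \<subseteq> {x..}" for A y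
    using that x by (auto simp: indicator_def)
  have "(\<lambda>i. \<integral>\<^sup>+y. ennreal (\<phi> y) * indicator {x..x + real i} y \<partial>lborel) \<longlonglongrightarrow> (\<integral>\<^sup>+y. ennreal (\<phi> y) * indicator {x..} y \<partial>lborel)"
  proof (rule nn_integral_LIMSEQ)
    show "incseq (\<lambda>i y. ennreal (\<phi> y) * indicator {x..x + real i} y)"
      by (auto simp: incseq_def le_fun_def indicator_def)
    show "(\<lambda>y. ennreal (\<phi> y) * indicator {x..x + real i} y) \<in> borel_measurable lborel" for i
      by (subst ind) auto
    fix y
    obtain N where "y - x \<le> real N" using real_arch_simple by blast
    then have "\<forall>\<^sub>F i in sequentially. ennreal (\<phi> y) * indicator {x..x + real i} y = ennreal (\<phi> y) * indicator {x..} y"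
      by (intro eventually_sequentiallyI[of N]) (auto simp: indicator_def)
    then show "(\<lambda>i. ennreal (\<phi> y) * indicator {x..x + real i} y) \<longlonglongrightarrow> ennreal (\<phi> y) * indicator {x..} y"
      by (rule tendsto_eventually)
  qed
  moreover have "(\<integral>\<^sup>+y. ennreal (\<phi> y) * indicator {x..x + real i} y \<partial>lborel) = ennreal (w x - w (x + real i))" for i
    using x nn by (intro nn_integral_has_integral_lebesgue' decrement_density_has_integral[OF dd]) auto
  moreover have "(\<lambda>i. ennreal (w x - w (x + real i))) \<longlonglongrightarrow> ennreal (w x - 0)"
    by (intro tendsto_ennrealI tendsto_diff tendsto_const filterlim_compose[OF w]
          filterlim_tendsto_add_at_top[OF tendsto_const] filterlim_real_sequentially)
  ultimately show ?thesis using LIMSEQ_unique by fastforce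
qed

section \<open>Monotone functions of order k as superpositions of truncated powers\<close>

text \<open>The parameter \<open>s > 0\<close> is a level and \<open>T s\<close> the point where that level is crossed; the law of
  \<open>T\<close> under Lebesgue measure plays the part of a mixing measure.\<close>

definition superposition :: "nat \<Rightarrow> (real \<Rightarrow> real) \<Rightarrow> real \<Rightarrow> ennreal" where
  "superposition m T x = (\<integral>\<^sup>+s. ennreal (dpow m (T s - x)) * indicator {0<..} s \<partial>lborel)"

text \<open>Integrating from \<open>x\<close> to infinity raises every truncated power by one degree.\<close>

lemma superposition_raise:
  assumes [measurable]: "T \<in> borel_measurable borel"
  shows "(\<integral>\<^sup>+y. superposition m T y * indicator {x..} y \<partial>lborel) = superposition (Suc m) T x"
proof -
  have "(\<integral>\<^sup>+y. superposition m T y * indicator {x..} y \<partial>lborel)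
      = (\<integral>\<^sup>+y. (\<integral>\<^sup>+s. ennreal (dpow m (T s - y)) * indicator {0<..} s * indicator {x..} y \<partial>lborel) \<partial>lborel)"
    unfolding superposition_def by (intro nn_integral_cong nn_integral_multc[symmetric]) measurable
  also have "\<dots> = (\<integral>\<^sup>+s. (\<integral>\<^sup>+y. ennreal (dpow m (T s - y)) * indicator {0<..} s * indicator {x..} y \<partial>lborel) \<partial>lborel)"
    by (rule lborel_pair.Fubini') measurable
  also have "\<dots> = (\<integral>\<^sup>+s. (\<integral>\<^sup>+y. ennreal (dpow m (T s - y)) * indicator {x..} y \<partial>lborel) * indicator {0<..} s \<partial>lborel)"
    by (subst nn_integral_multc[symmetric]) (auto intro!: nn_integral_cong simp: mult_ac)
  finally show ?thesis by (simp add: nn_integral_dpow_right superposition_def)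
qed

text \<open>The level set of \<open>\<phi>\<close> above \<open>s\<close> is an interval with left end point \<open>0\<close> and right end point
  \<open>T s\<close>, which may or may not contain \<open>T s\<close>. Including \<open>T s\<close> gives the inequality; the two sides
  differ at \<open>x\<close> only if \<open>T\<close> takes the value \<open>x\<close> on a set of positive measure, which by Tonelli
  happens for almost no \<open>x\<close>.\<close>

lemma layer_cake_antimono:
  fixes \<phi> :: "real \<Rightarrow> real"
  assumes anti: "antimono_on {0<..} \<phi>" and nn: "\<And>x. 0 < x \<Longrightarrow> 0 \<le> \<phi> x" and lim: "(\<phi> \<longlongrightarrow> 0) at_top"
  obtains T where "T \<in> borel_measurable borel"
    "\<And>x. 0 < x \<Longrightarrow> ennreal (\<phi> x) \<le> superposition 0 T x"
    "AE x in lborel. 0 < x \<longrightarrow> ennreal (\<phi> x) = superposition 0 T x"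
proof -
  \<comment> \<open>Adjoining \<open>0\<close> makes the supremum meaningful for levels that \<open>\<phi>\<close> never exceeds; a truncated power
    with vertex \<open>0\<close> vanishes on the half-line.\<close>
  define T0 where "T0 s = Sup (insert 0 {x. 0 < x \<and> s < \<phi> x})" for s
  define T where "T s = indicator {0<..} s * T0 s" for s
  have bdd: "bdd_above (insert 0 {x. 0 < x \<and> s < \<phi> x})" if "0 < s" for s
  proof -
    obtain B where B: "\<And>x. x \<ge> B \<Longrightarrow> \<phi> x < s"
      using order_tendstoD(2)[OF lim \<open>0 < s\<close>] by (auto simp: eventually_at_top_linorder)
    have "x \<le> B" if "s < \<phi> x" for x using B[of x] that by linarith
    then show ?thesis by (intro bdd_aboveI[of _ "max B 0"]) fastforce
  qed
  have "mono_on {0<..} (\<lambda>s. - T0 s)"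
  proof (rule monotone_onI)
    fix s s' :: real assume s: "s \<in> {0<..}" "s' \<in> {0<..}" "s \<le> s'"
    have "T0 s' \<le> T0 s"
      unfolding T0_def by (intro cSup_subset_mono bdd) (use s in auto)
    then show "- T0 s \<le> - T0 s'" by simp
  qed
  then have "(\<lambda>s. - T0 s) \<in> borel_measurable (restrict_space borel {0<..})"
    by (rule borel_measurable_mono_on_fnc)
  then have "(\<lambda>s. indicator {0<..} s *\<^sub>R (- T0 s)) \<in> borel_measurable borel"
    by (subst (asm) borel_measurable_restrict_space_iff) auto
  then have T_meas [measurable]: "T \<in> borel_measurable borel"
    unfolding T_def by simp
  have upper: "x \<le> T s" if "0 < s" "0 < x" "s < \<phi> x" for s x
    using that bdd[of s] by (auto simp: T_def T0_def intro!: cSup_upper)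
  have lower: "s < \<phi> x" if s: "0 < s" "0 < x" "x < T s" for s x
  proof -
    have "x < Sup (insert 0 {x. 0 < x \<and> s < \<phi> x})" using s by (simp add: T_def T0_def)
    then obtain y where "y \<in> insert 0 {x. 0 < x \<and> s < \<phi> x}" "x < y"
      using less_cSup_iff[OF _ bdd[OF s(1)]] by blast
    then have y: "s < \<phi> y" "x < y" using s by auto
    then have "\<phi> y \<le> \<phi> x" using anti s by (auto simp: monotone_on_def)
    then show ?thesis using y by simp
  qed
  have len: "(\<integral>\<^sup>+s. indicator {0<..<c} s \<partial>lborel) = ennreal c" if "0 \<le> c" for c :: real
    using that by simp
  have ge: "ennreal (\<phi> x) \<le> superposition 0 T x" if "0 < x" for x
    unfolding superposition_def len[OF nn[OF that], symmetric]
    using upper[OF _ that] by (intro nn_integral_mono) (auto simp: indicator_def dpow_0)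
  \<comment> \<open>The graph of \<open>T\<close> is a null set in the plane.\<close>
  have "(\<integral>\<^sup>+x. (\<integral>\<^sup>+s. indicator {T s} x \<partial>lborel) \<partial>lborel) = (\<integral>\<^sup>+s. (\<integral>\<^sup>+x. indicator {T s} x \<partial>lborel) \<partial>lborel)"
  proof (rule lborel_pair.Fubini')
    have "(\<lambda>(s, x). if x = T s then 1 else 0 :: ennreal) \<in> borel_measurable (lborel \<Otimes>\<^sub>M lborel)" by measurable
    moreover have "(\<lambda>(s, x). if x = T s then 1 else 0 :: ennreal) = (\<lambda>(s, x). indicator {T s} x)"
      by (auto simp: fun_eq_iff indicator_def)
    ultimately show "(\<lambda>(s, x). indicator {T s} x :: ennreal) \<in> borel_measurable (lborel \<Otimes>\<^sub>M lborel)" by simp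
  qed
  also have "\<dots> = 0" by simp
  finally have "(\<integral>\<^sup>+x. (\<integral>\<^sup>+s. indicator {T s} x \<partial>lborel) \<partial>lborel) = 0" .
  moreover have meas2: "(\<lambda>s. indicator {T s} x :: ennreal) \<in> borel_measurable borel" for x
  proof -
    have "(\<lambda>s. if x = T s then 1 else 0 :: ennreal) \<in> borel_measurable borel" by measurable
    then show ?thesis by (rule measurable_cong[THEN iffD1, rotated]) (auto simp: indicator_def)
  qed
  moreover have "(\<lambda>x. \<integral>\<^sup>+s. indicator {T s} x \<partial>lborel :: ennreal) \<in> borel_measurable lborel"
  proof -
    have "(\<lambda>x. \<integral>\<^sup>+s. (if x = T s then 1 else 0 :: ennreal) \<partial>lborel) \<in> borel_measurable lborel" by measurable
    moreover have "(\<lambda>x. \<integral>\<^sup>+s. (if x = T s then 1 else 0 :: ennreal) \<partial>lborel) = (\<lambda>x. \<integral>\<^sup>+s. indicator {T s} x \<partial>lborel)"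
      by (auto simp: fun_eq_iff indicator_def intro!: nn_integral_cong)
    ultimately show ?thesis by simp
  qed
  ultimately have null: "AE x in lborel. (\<integral>\<^sup>+s. indicator {T s} x \<partial>lborel) = (0::ennreal)"
    by (subst (asm) nn_integral_0_iff_AE) auto
  have le: "superposition 0 T x \<le> ennreal (\<phi> x) + (\<integral>\<^sup>+s. indicator {T s} x \<partial>lborel)" if "0 < x" for x
  proof -
    have "superposition 0 T x \<le> (\<integral>\<^sup>+s. indicator {0<..<\<phi> x} s + indicator {T s} x \<partial>lborel)"
      unfolding superposition_def using lower[OF _ that]
      by (intro nn_integral_mono) (auto simp: indicator_def dpow_0)
    also have "\<dots> = (\<integral>\<^sup>+s. indicator {0<..<\<phi> x} s \<partial>lborel) + (\<integral>\<^sup>+s. indicator {T s} x \<partial>lborel)"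
      using meas2 by (intro nn_integral_add) auto
    finally show ?thesis by (simp only: len[OF nn[OF that]])
  qed
  from null have "AE x in lborel. 0 < x \<longrightarrow> ennreal (\<phi> x) = superposition 0 T x"
  proof eventually_elim
    case (elim x)
    then show ?case using ge[of x] le[of x] by auto
  qed
  then show ?thesis using that T_meas ge by blast
qed

text \<open>The sequence \<open>h, - h', h'', \<dots>\<close> of an \<open>(m + 1)\<close>-monotone function, whose last member may be
  a negated subgradient of the one before.\<close>

definition decrement_chain :: "nat \<Rightarrow> (nat \<Rightarrow> real \<Rightarrow> real) \<Rightarrow> bool" where
  "decrement_chain m u \<longleftrightarrow>
     (\<forall>l\<le>m. (\<forall>x>0. 0 \<le> u l x) \<and> antimono_on {0<..} (u l)) \<and> (\<forall>l<m. decrement_density (u l) (u (Suc l)))"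

text \<open>Induction from the last member of the chain, which has a layer-cake decomposition, to the first:
  each member is the integral of the next one from \<open>x\<close> to infinity. Equality everywhere is lost
  only for \<open>m = 0\<close>, where \<open>u 0\<close> may fail to be left-continuous at a jump; the inequality that
  survives is in the direction in which a sample mean of \<open>u 0\<close> has to be bounded.\<close>

lemma decrement_chain_superposition:
  assumes "decrement_chain m u" and "(u 0 \<longlongrightarrow> 0) at_top"
  shows "\<exists>T \<in> borel_measurable borel. (\<forall>x>0. ennreal (u 0 x) \<le> superposition m T x) \<and>
           (AE x in lborel. 0 < x \<longrightarrow> ennreal (u 0 x) = superposition m T x)"
  using assms
proof (induction m arbitrary: u)
  case 0
  then have "antimono_on {0<..} (u 0)" "\<And>x. 0 < x \<Longrightarrow> 0 \<le> u 0 x" by (auto simp: decrement_chain_def)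
  from layer_cake_antimono[OF this 0(2)] show ?case by metis
next
  case (Suc m)
  have dd: "decrement_density (u 0) (u 1)" and nn: "\<And>x. 0 < x \<Longrightarrow> 0 \<le> u 1 x"
    using Suc.prems(1) by (auto simp: decrement_chain_def)
  have "decrement_chain m (\<lambda>l. u (Suc l))" using Suc.prems(1) by (auto simp: decrement_chain_def)
  moreover have "(u (Suc 0) \<longlongrightarrow> 0) at_top"
    using decrement_density_tendsto_0[OF dd nn Suc.prems(2)] by simp
  ultimately obtain T where [measurable]: "T \<in> borel_measurable borel"
      and T: "AE x in lborel. 0 < x \<longrightarrow> ennreal (u 1 x) = superposition m T x"
    using Suc.IH[of "\<lambda>l. u (Suc l)"] by auto
  have eq: "ennreal (u 0 x) = superposition (Suc m) T x" if "0 < x" for x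
  proof -
    have "ennreal (u 0 x) = (\<integral>\<^sup>+y. ennreal (u 1 y) * indicator {x..} y \<partial>lborel)"
      by (rule nn_integral_decrement_density[OF dd nn Suc.prems(2) that, symmetric])
    also have "\<dots> = (\<integral>\<^sup>+y. superposition m T y * indicator {x..} y \<partial>lborel)"
    proof (rule nn_integral_cong_AE)
      show "AE y in lborel. ennreal (u 1 y) * indicator {x..} y = superposition m T y * indicator {x..} y"
        using T by eventually_elim (use that in \<open>simp add: indicator_def\<close>)
    qed
    finally show ?thesis by (simp add: superposition_raise)
  qed
  show ?case
    by (rule bexI[of _ T]) (auto simp: eq)
qed

lemma antimono_decrement_density_of_derivative:
  assumes "\<And>x. 0 < x \<Longrightarrow> (w has_real_derivative - \<phi> x) (at x)" and anti: "antimono_on {0<..} \<phi>"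
  shows "decrement_density w \<phi>"
  unfolding decrement_density_def
proof (intro allI impI)
  fix a b :: real assume ab: "0 < a" "a < b"
  obtain z where z: "a < z" "z < b" "w b - w a = (b - a) * - \<phi> z"
    using MVT2[OF ab(2), of w "\<lambda>x. - \<phi> x"] assms(1) ab by auto
  have "\<phi> b \<le> \<phi> z" "\<phi> z \<le> \<phi> a" using anti z ab by (auto simp: monotone_on_def)
  then have "\<phi> b * (b - a) \<le> \<phi> z * (b - a)" "\<phi> z * (b - a) \<le> \<phi> a * (b - a)"
    using ab by (auto intro: mult_right_mono)
  then show "\<phi> b * (b - a) \<le> w a - w b \<and> w a - w b \<le> \<phi> a * (b - a)"
    using z(3) by (simp add: algebra_simps)
qed

text \<open>The negated right derivative serves as \<open>\<phi>\<close>: being a subgradient, it bounds chord slopes on both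
  sides.\<close>

lemma convex_antimono_decrement_density:
  fixes w :: "real \<Rightarrow> real"
  assumes conv: "convex_on {0<..} w" and anti: "antimono_on {0<..} w"
  obtains \<phi> where "decrement_density w \<phi>" "\<And>x. 0 < x \<Longrightarrow> 0 \<le> \<phi> x"
proof -
  \<comment> \<open>The infimum is over the chords to the right of \<open>x\<close> and so equals the right derivative.\<close>
  define \<phi> where "\<phi> x = - Inf ((\<lambda>t. (w x - w t) / (x - t)) ` ({x<..} \<inter> {0<..}))" for x
  have sub: "w y \<ge> w x - \<phi> x * (y - x)" if "0 < x" "0 < y" for x y
    using convex_le_Inf_differential[OF conv, of x y] that by (simp add: \<phi>_def interior_open)
  have dd: "decrement_density w \<phi>"
    unfolding decrement_density_def
  proof (intro allI impI)
    fix a b :: real assume "0 < a" "a < b"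
    then show "\<phi> b * (b - a) \<le> w a - w b \<and> w a - w b \<le> \<phi> a * (b - a)"
      using sub[of a b] sub[of b a] by (simp add: algebra_simps)
  qed
  moreover have "0 \<le> \<phi> x" if "0 < x" for x
  proof -
    have "0 \<le> w x - w (x + 1)" using anti that by (auto simp: monotone_on_def)
    also have "\<dots> \<le> \<phi> x * ((x + 1) - x)"
      using dd[unfolded decrement_density_def, rule_format, of x "x + 1"] that by simp
    finally show ?thesis by simp
  qed
  ultimately show ?thesis by (rule that)
qed

lemma deriv_funpow_differentiable:
  fixes g :: "real \<Rightarrow> real"
  assumes "(deriv ^^ l) g differentiable (at x)"
  shows "((deriv ^^ l) g has_real_derivative (deriv ^^ Suc l) g x) (at x)"
  using assms by (auto simp: DERIV_deriv_iff_real_differentiable)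

text \<open>The functions \<open>v l\<close> act as \<open>(-1) ^ l\<close> times the \<open>l\<close>-th derivative of \<open>v 0\<close>. Iterates of
  \<^const>\<open>deriv\<close> are awkward to manipulate on the half-line, whereas such a family is easily
  written down for sums and for truncated powers.\<close>

definition signed_derivatives :: "nat \<Rightarrow> (nat \<Rightarrow> real \<Rightarrow> real) \<Rightarrow> bool" where
  "signed_derivatives m v \<longleftrightarrow>
     (\<forall>l<m. \<forall>x>0. (v l has_real_derivative - v (Suc l) x) (at x)) \<and>
     (\<forall>l\<le>m. (\<forall>x>0. 0 \<le> v l x) \<and> antimono_on {0<..} (v l) \<and> convex_on {0<..} (v l))"

lemma k_monotone_signed_derivatives:
  assumes "k_monotone k h" "k \<noteq> 1"
  shows "signed_derivatives (k - 2) (\<lambda>l x. (- 1) ^ l * (deriv ^^ l) h x)"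
proof -
  have "((\<lambda>x. (- 1) ^ l * (deriv ^^ l) h x) has_real_derivative - ((- 1) ^ Suc l * (deriv ^^ Suc l) h x)) (at x)"
    if "l < k - 2" "0 < x" for l x
  proof -
    have "(deriv ^^ l) h differentiable (at x)" using that assms by (auto simp: k_monotone_def)
    from deriv_funpow_differentiable[OF this] show ?thesis by (auto intro!: derivative_eq_intros)
  qed
  then show ?thesis using assms by (simp add: signed_derivatives_def k_monotone_def)
qed

lemma k_monotone_if_signed_derivatives:
  assumes v: "signed_derivatives (k - 2) v" and h: "\<And>x. 0 < x \<Longrightarrow> h x = v 0 x" and "k \<noteq> 1"
  shows "k_monotone k h"
proof -
  have deriv: "(v l has_real_derivative - v (Suc l) x) (at x)" if "l < k - 2" "0 < x" for l x
    using v that by (simp add: signed_derivatives_def)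
  have eq: "(deriv ^^ l) h x = (- 1) ^ l * v l x" if "l \<le> k - 2" "0 < x" for l x
    using that
  proof (induction l arbitrary: x)
    case (Suc l)
    have "((\<lambda>x. (- 1) ^ l * v l x) has_real_derivative (- 1) ^ Suc l * v (Suc l) x) (at x)"
      using Suc.prems by (auto intro!: derivative_eq_intros deriv)
    then have "((deriv ^^ l) h has_real_derivative (- 1) ^ Suc l * v (Suc l) x) (at x)"
      by (rule has_field_derivative_transform_within_open[where S = "{0<..}"]) (use Suc in auto)
    then show ?case by (simp add: DERIV_imp_deriv)
  qed (simp add: h)
  have diff: "(deriv ^^ l) h differentiable (at x)" if "l < k - 2" "0 < x" for l x
  proof -
    have "((\<lambda>x. (- 1) ^ l * v l x) has_real_derivative (- 1) ^ Suc l * v (Suc l) x) (at x)"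
      using that by (auto intro!: derivative_eq_intros deriv)
    then have "((deriv ^^ l) h has_real_derivative (- 1) ^ Suc l * v (Suc l) x) (at x)"
      by (rule has_field_derivative_transform_within_open[where S = "{0<..}"]) (use that eq in auto)
    then show ?thesis by (auto simp: real_differentiable_def)
  qed
  have sgn: "(- 1) ^ l * (deriv ^^ l) h x = v l x" if "l \<le> k - 2" "0 < x" for l x
    unfolding eq[OF that] mult.assoc[symmetric] power_mult_distrib[symmetric] by simp
  have "(\<forall>x>0. 0 \<le> (- 1) ^ l * (deriv ^^ l) h x) \<and> antimono_on {0<..} (\<lambda>x. (- 1) ^ l * (deriv ^^ l) h x)
      \<and> convex_on {0<..} (\<lambda>x. (- 1) ^ l * (deriv ^^ l) h x)" if l: "l \<le> k - 2" for l
  proof (intro conjI allI impI)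
    have vl: "\<And>x. 0 < x \<Longrightarrow> 0 \<le> v l x" "antimono_on {0<..} (v l)" "convex_on {0<..} (v l)"
      using v l by (auto simp: signed_derivatives_def)
    show "0 \<le> (- 1) ^ l * (deriv ^^ l) h x" if "0 < x" for x
      using vl(1)[OF that] sgn[OF l that] by simp
    show "antimono_on {0<..} (\<lambda>x. (- 1) ^ l * (deriv ^^ l) h x)"
      using vl(2) sgn[OF l] by (simp add: monotone_on_def)
    show "convex_on {0<..} (\<lambda>x. (- 1) ^ l * (deriv ^^ l) h x)"
    proof (rule convex_onI)
      fix t x y :: real assume t: "0 < t" "t < 1" and xy: "x \<in> {0<..}" "y \<in> {0<..}"
      then have "0 < (1 - t) *\<^sub>R x + t *\<^sub>R y" by (simp add: add_pos_pos)
      then show "(- 1) ^ l * (deriv ^^ l) h ((1 - t) *\<^sub>R x + t *\<^sub>R y)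
          \<le> (1 - t) * ((- 1) ^ l * (deriv ^^ l) h x) + t * ((- 1) ^ l * (deriv ^^ l) h y)"
        using convex_onD[OF vl(3), of t x y] t xy by (simp only: sgn[OF l] greaterThan_iff less_imp_le)
    qed simp
  qed
  then show ?thesis using diff \<open>k \<noteq> 1\<close> by (simp add: k_monotone_def)
qed

lemma k_monotone_decrement_chain:
  assumes "1 \<le> k" "k_monotone k h"
  obtains u where "decrement_chain (k - 1) u" "u 0 = h"
proof (cases "k = 1")
  case True
  then show ?thesis using assms(2) that[of "\<lambda>_. h"] by (auto simp: decrement_chain_def k_monotone_def)
next
  case False
  define v where "v l x = (- 1) ^ l * (deriv ^^ l) h x" for l x
  have "signed_derivatives (k - 2) v"
    using k_monotone_signed_derivatives[OF assms(2) False] by (simp add: v_def[abs_def])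
  then have deriv: "\<And>l x. l < k - 2 \<Longrightarrow> 0 < x \<Longrightarrow> (v l has_real_derivative - v (Suc l) x) (at x)"
    and nn: "\<And>l x. l \<le> k - 2 \<Longrightarrow> 0 < x \<Longrightarrow> 0 \<le> v l x"
    and anti: "\<And>l. l \<le> k - 2 \<Longrightarrow> antimono_on {0<..} (v l)"
    and conv: "\<And>l. l \<le> k - 2 \<Longrightarrow> convex_on {0<..} (v l)"
    by (auto simp: signed_derivatives_def)
  obtain \<phi> where \<phi>: "decrement_density (v (k - 2)) \<phi>" "\<And>x. 0 < x \<Longrightarrow> 0 \<le> \<phi> x"
    using convex_antimono_decrement_density[OF conv[OF order_refl] anti[OF order_refl]] by blast
  have dv: "decrement_density (v l) (v (Suc l))" if l: "l < k - 2" for l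
    using l by (intro antimono_decrement_density_of_derivative deriv anti) auto
  obtain j where k: "k - 1 = Suc j" "k - 2 = j"
  proof
    show "k - 1 = Suc (k - 2)" using False assms(1) by simp
  qed (rule refl)
  define u where "u l = (if l = Suc j then \<phi> else v l)" for l
  have "decrement_chain (k - 1) u"
    unfolding decrement_chain_def k
  proof (intro conjI allI impI)
    show "0 \<le> u l x" if "l \<le> Suc j" "0 < x" for l x
      using that nn[of l x] \<phi>(2)[of x] by (auto simp: u_def k)
    show "antimono_on {0<..} (u l)" if "l \<le> Suc j" for l
      using that anti[of l] decrement_density_antimono[OF \<phi>(1)] by (cases "l = Suc j") (auto simp: u_def k)
    show "decrement_density (u l) (u (Suc l))" if "l < Suc j" for l
      using that dv[of l] \<phi>(1) by (cases "l = j") (auto simp: u_def k)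
  qed
  moreover have "u 0 = h" by (simp add: u_def v_def fun_eq_iff)
  ultimately show ?thesis by (rule that)
qed

lemma k_monotone_superposition:
  assumes "1 \<le> k" "k_monotone k h" "(h \<longlongrightarrow> 0) at_top"
  obtains T where "T \<in> borel_measurable borel"
    "\<And>x. 0 < x \<Longrightarrow> ennreal (h x) \<le> superposition (k - 1) T x"
    "AE x in lborel. 0 < x \<longrightarrow> ennreal (h x) = superposition (k - 1) T x"
proof -
  obtain u where u: "decrement_chain (k - 1) u" "u 0 = h"
    using k_monotone_decrement_chain[OF assms(1,2)] .
  show ?thesis using decrement_chain_superposition[OF u(1)] u(2) assms(3) that by blast
qed

lemma k_monotone_nonneg_antimono:
  assumes "1 \<le> k" "k_monotone k h"
  shows "0 < x \<Longrightarrow> 0 \<le> h x" "antimono_on {0<..} h"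
proof -
  obtain u where u: "decrement_chain (k - 1) u" "u 0 = h"
    using k_monotone_decrement_chain[OF assms] .
  have "(\<forall>x>0. 0 \<le> u 0 x) \<and> antimono_on {0<..} (u 0)"
    using u(1) unfolding decrement_chain_def by blast
  then show "0 < x \<Longrightarrow> 0 \<le> h x" "antimono_on {0<..} h"
    unfolding u(2) by blast+
qed

lemma space_lambda_pos [simp]: "space lambda_pos = {0<..}"
  by (simp add: lambda_pos_def space_restrict_space)

lemma emeasure_lambda_pos_space: "emeasure lambda_pos {0<..} = \<infinity>"
proof -
  have "ennreal (real n) \<le> emeasure lborel {0::real<..}" for n
  proof -
    have "{0<..real n} \<subseteq> {0<..}" by auto
    from emeasure_mono[OF this, of lborel] show ?thesis by simp
  qed
  then have "(SUP n. of_nat n :: ennreal) \<le> emeasure lborel {0::real<..}"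
    by (intro SUP_least) (simp add: ennreal_of_nat_eq_real_of_nat)
  then have "emeasure lborel {0::real<..} = \<infinity>"
    unfolding ennreal_SUP_of_nat_eq_top by (simp add: top_unique)
  then show ?thesis by (simp add: lambda_pos_def emeasure_restrict_space)
qed

text \<open>A function that stayed above \<open>c > 0\<close> would have a square with integral at least
  \<open>c\<^sup>2 * \<infinity>\<close>.\<close>

lemma L2_antimono_tendsto_0:
  assumes nn: "\<And>x. 0 < x \<Longrightarrow> 0 \<le> h x" and anti: "antimono_on {0<..} h" and L2: "h \<in> L2_pos"
  shows "(h \<longlongrightarrow> 0) at_top"
proof (rule order_tendstoI)
  fix c :: real assume "c < 0"
  show "\<forall>\<^sub>F x in at_top. c < h x"
    using eventually_gt_at_top[of "0::real"]
  proof eventually_elim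
    case (elim x)
    then show ?case using nn[OF elim] \<open>c < 0\<close> by simp
  qed
next
  fix c :: real assume c: "0 < c"
  have "\<exists>x>0. h x < c"
  proof (rule ccontr)
    assume "\<not> (\<exists>x>0. h x < c)"
    then have ge: "c\<^sup>2 \<le> (h x)\<^sup>2" if "0 < x" for x
      using that c by (intro power_mono) (meson not_le less_imp_le)+
    have "(\<integral>\<^sup>+x. ennreal ((h x)\<^sup>2) \<partial>lambda_pos) < \<infinity>"
      using L2 unfolding L2_pos_def by (simp add: integrable_iff_bounded)
    moreover have "(\<integral>\<^sup>+x. ennreal (c\<^sup>2) \<partial>lambda_pos) \<le> (\<integral>\<^sup>+x. ennreal ((h x)\<^sup>2) \<partial>lambda_pos)"
      using ge by (intro nn_integral_mono) (auto simp: lambda_pos_def space_restrict_space intro!: ennreal_leI)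
    moreover have "(\<integral>\<^sup>+x. ennreal (c\<^sup>2) \<partial>lambda_pos) = \<infinity>"
      using c emeasure_lambda_pos_space by (simp add: ennreal_mult_top)
    ultimately show False by simp
  qed
  then obtain x0 where "0 < x0" "h x0 < c" by blast
  then have "h x < c" if "x0 \<le> x" for x
    using monotone_onD[OF anti, of x0 x] that by simp
  then show "\<forall>\<^sub>F x in at_top. h x < c" by (auto simp: eventually_at_top_linorder)
qed

section \<open>Cauchy's formula for the iterated integrals\<close>

lemma measurable_ident_lambda_pos [measurable]: "(\<lambda>x. x) \<in> lambda_pos \<rightarrow>\<^sub>M borel"
  unfolding lambda_pos_def by (rule measurable_restrict_space1) simp

lemma nn_integral_lambda_pos:
  "(\<integral>\<^sup>+x. f x \<partial>lambda_pos) = (\<integral>\<^sup>+x. f x * indicator {0<..} x \<partial>lborel)"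
  unfolding lambda_pos_def by (rule nn_integral_restrict_space) simp

interpretation lambda_pos: sigma_finite_measure lambda_pos
  unfolding lambda_pos_def by (rule sigma_finite_measure_restrict_space) (auto intro: lborel.sigma_finite_measure_axioms)

lemma integrable_mult_L2:
  assumes "f \<in> L2_pos" "h \<in> L2_pos"
  shows "integrable lambda_pos (\<lambda>x. f x * h x)"
proof (rule Bochner_Integration.integrable_bound)
  show "integrable lambda_pos (\<lambda>x. (f x)\<^sup>2 + (h x)\<^sup>2)"
    using assms by (simp add: L2_pos_def)
  show "(\<lambda>x. f x * h x) \<in> borel_measurable lambda_pos"
    using assms unfolding L2_pos_def by (intro borel_measurable_times) auto
  have "\<bar>a * b\<bar> \<le> a\<^sup>2 + b\<^sup>2" for a b :: real
  proof -
    have "2 * (\<bar>a\<bar> * \<bar>b\<bar>) \<le> a\<^sup>2 + b\<^sup>2"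
      using sum_squares_bound[of "\<bar>a\<bar>" "\<bar>b\<bar>"] by simp
    moreover have "0 \<le> \<bar>a\<bar> * \<bar>b\<bar>" by simp
    ultimately show ?thesis unfolding abs_mult by linarith
  qed
  then show "AE x in lambda_pos. norm (f x * h x) \<le> norm ((f x)\<^sup>2 + (h x)\<^sup>2)"
    by (intro AE_I2) simp
qed

lemma dpow_L2: "(\<lambda>x. dpow m (t - x)) \<in> L2_pos"
proof -
  define C where "C = (\<bar>t\<bar> ^ m / fact m)\<^sup>2"
  have le: "(dpow m (t - x))\<^sup>2 \<le> C * indicator {0<..t} x" if "0 < x" for x
    using that unfolding dpow_def trunc_power_def C_def
    by (auto simp: indicator_def intro!: power_mono divide_right_mono)
  have "(\<integral>\<^sup>+x. ennreal ((dpow m (t - x))\<^sup>2) \<partial>lambda_pos) \<le> (\<integral>\<^sup>+x. ennreal C * indicator {0<..t} x \<partial>lborel)"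
    unfolding nn_integral_lambda_pos
  proof (rule nn_integral_mono)
    fix x :: real
    show "ennreal ((dpow m (t - x))\<^sup>2) * indicator {0<..} x \<le> ennreal C * indicator {0<..t} x"
    proof (cases "0 < x")
      case True
      then have "ennreal ((dpow m (t - x))\<^sup>2) \<le> ennreal (C * indicator {0<..t} x)"
        by (intro ennreal_leI le)
      with True show ?thesis by (auto simp: indicator_def split: if_splits)
    qed simp
  qed
  also have "\<dots> < \<infinity>" by (cases "0 \<le> t") (simp_all add: nn_integral_cmult_indicator ennreal_mult_less_top)
  finally have "integrable lambda_pos (\<lambda>x. (dpow m (t - x))\<^sup>2)"
    by (intro integrableI_bounded) auto
  then show ?thesis by (simp add: L2_pos_def)
qed

lemma iter_integral_Suc: "iter_integral (Suc m) f t = (LBINT s:{0<..t}. iter_integral m f s)"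
  by (simp add: iter_integral_def)

lemma iter_integral_emp_cdf:
  assumes pos: "\<And>i. i \<in> {1..n} \<Longrightarrow> 0 < x i"
  shows "iter_integral m (emp_cdf n x) t = (\<Sum>i = 1..n. dpow m (t - x i)) / real n"
proof (induction m arbitrary: t)
  case 0
  have "dpow 0 (t - x i) = indicator {..t} (x i)" for i by (simp add: dpow_0 indicator_def)
  then show ?case by (simp add: iter_integral_def emp_cdf_def)
next
  case (Suc m)
  have "has_bochner_integral lborel (\<lambda>s. \<Sum>i = 1..n. indicator {0<..t} s * dpow m (s - x i))
      (\<Sum>i = 1..n. dpow (Suc m) (t - x i))"
  proof (intro has_bochner_integral_sum has_bochner_integral_nn_integral)
    fix i assume "i \<in> {1..n}"
    from nn_integral_dpow_left[OF pos[OF this], of m t]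
    show "(\<integral>\<^sup>+s. ennreal (indicator {0<..t} s * dpow m (s - x i)) \<partial>lborel) = ennreal (dpow (Suc m) (t - x i))"
      by (simp add: ennreal_mult' ennreal_indicator mult.commute)
  qed auto
  then have "has_bochner_integral lborel (\<lambda>s. (\<Sum>i = 1..n. indicator {0<..t} s * dpow m (s - x i)) / real n)
      ((\<Sum>i = 1..n. dpow (Suc m) (t - x i)) / real n)"
    by (rule has_bochner_integral_divide_zero)
  from has_bochner_integral_integral_eq[OF this] show ?case
    unfolding iter_integral_Suc set_lebesgue_integral_def Suc.IH
    by (simp only: real_scaleR_def sum_distrib_left times_divide_eq_right)
qed

lemma nn_integral_dpow_L2:
  assumes g: "g \<in> L2_pos" and nn: "\<And>x. 0 < x \<Longrightarrow> 0 \<le> g x"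
  shows "(\<integral>\<^sup>+x. ennreal (g x) * ennreal (dpow m (t - x)) \<partial>lambda_pos) = ennreal (\<integral>x. g x * dpow m (t - x) \<partial>lambda_pos)"
proof -
  have "(\<integral>\<^sup>+x. ennreal (g x) * ennreal (dpow m (t - x)) \<partial>lambda_pos) = (\<integral>\<^sup>+x. ennreal (g x * dpow m (t - x)) \<partial>lambda_pos)"
    using nn by (intro nn_integral_cong) (simp add: ennreal_mult)
  also have "\<dots> = ennreal (\<integral>x. g x * dpow m (t - x) \<partial>lambda_pos)"
    using nn by (intro nn_integral_eq_integral integrable_mult_L2 g dpow_L2 AE_I2) simp
  finally show ?thesis .
qed

text \<open>Square-integrability makes \<open>g\<close> integrable near \<open>0\<close>, so that all inner integrals are finite and
  the induction is Tonelli together with \<open>nn_integral_dpow_left\<close>.\<close>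

lemma iter_integral_L2:
  assumes g: "g \<in> L2_pos" and nn: "\<And>x. 0 < x \<Longrightarrow> 0 \<le> g x"
  shows "iter_integral (Suc m) g t = (\<integral>x. g x * dpow m (t - x) \<partial>lambda_pos)"
proof (induction m arbitrary: t)
  case 0
  have "iter_integral (Suc 0) g t = (\<integral>s. indicator {0<..t} s *\<^sub>R g s \<partial>lborel)"
    by (simp add: iter_integral_def set_lebesgue_integral_def)
  also have "\<dots> = (\<integral>x. indicator {0<..} x *\<^sub>R (g x * dpow 0 (t - x)) \<partial>lborel)"
    by (intro Bochner_Integration.integral_cong) (auto simp: indicator_def dpow_0)
  also have "\<dots> = (\<integral>x. g x * dpow 0 (t - x) \<partial>lambda_pos)"
    unfolding lambda_pos_def by (rule integral_restrict_space[symmetric]) simp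
  finally show ?case .
next
  case (Suc m)
  have [measurable]: "g \<in> borel_measurable lambda_pos" using g by (simp add: L2_pos_def)
  interpret pair_sigma_finite lambda_pos lborel ..
  define I where "I m s = (\<integral>x. g x * dpow m (s - x) \<partial>lambda_pos)" for m s
  have [measurable]: "I m \<in> borel_measurable borel" unfolding I_def by measurable
  have I_nn: "0 \<le> I m s" for m s
    unfolding I_def using nn by (intro integral_nonneg_AE AE_I2) simp
  have "(\<integral>\<^sup>+s. ennreal (indicator {0<..t} s *\<^sub>R I m s) \<partial>lborel)
      = (\<integral>\<^sup>+s. ennreal (I m s) * indicator {0<..t} s \<partial>lborel)"
    by (intro nn_integral_cong) (simp add: indicator_def)
  also have "\<dots> = (\<integral>\<^sup>+s. (\<integral>\<^sup>+x. ennreal (g x) * (ennreal (dpow m (s - x)) * indicator {0<..t} s) \<partial>lambda_pos) \<partial>lborel)"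
  proof (rule nn_integral_cong)
    fix s
    show "ennreal (I m s) * indicator {0<..t} s
        = (\<integral>\<^sup>+x. ennreal (g x) * (ennreal (dpow m (s - x)) * indicator {0<..t} s) \<partial>lambda_pos)"
      using nn_integral_multc[of "\<lambda>x. ennreal (g x) * ennreal (dpow m (s - x))" lambda_pos "indicator {0<..t} s"]
      by (simp add: nn_integral_dpow_L2[OF g nn] I_def mult.assoc)
  qed
  also have "\<dots> = (\<integral>\<^sup>+x. (\<integral>\<^sup>+s. ennreal (g x) * (ennreal (dpow m (s - x)) * indicator {0<..t} s) \<partial>lborel) \<partial>lambda_pos)"
    by (rule Fubini') measurable
  also have "\<dots> = (\<integral>\<^sup>+x. ennreal (g x) * ennreal (dpow (Suc m) (t - x)) \<partial>lambda_pos)"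
    by (intro nn_integral_cong) (simp add: nn_integral_cmult nn_integral_dpow_left)
  also have "\<dots> = ennreal (I (Suc m) t)" by (simp add: nn_integral_dpow_L2[OF g nn] I_def)
  finally have "has_bochner_integral lborel (\<lambda>s. indicator {0<..t} s *\<^sub>R I m s) (I (Suc m) t)"
    by (intro has_bochner_integral_nn_integral) (auto simp: I_nn)
  then show ?case
    unfolding iter_integral_Suc[of "Suc m"] set_lebesgue_integral_def Suc.IH I_def
    by (rule has_bochner_integral_integral_eq)
qed

section \<open>The criterion as a quadratic functional on a cone\<close>

text \<open>The measure with distribution function \<open>emp_cdf n x\<close> is the law of \<open>x i\<close> for a uniformly
  chosen index \<open>i\<close>, because the distribution functions agree.\<close>

lemma integral_interval_measure_emp_cdf:
  assumes "1 \<le> n" and pos: "\<And>i. i \<in> {1..n} \<Longrightarrow> 0 < x i" and h: "h \<in> borel_measurable lambda_pos"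
  shows "(LINT u:{0<..}|interval_measure (emp_cdf n x). h u) = (\<Sum>i = 1..n. h (x i)) / real n"
proof -
  define p where "p = pmf_of_set {1..n}"
  define D where "D = distr (measure_pmf p) borel x"
  have ne: "finite {1..n}" "{1..n} \<noteq> {}" using \<open>1 \<le> n\<close> by auto
  interpret D: real_distribution D
    unfolding D_def by (rule prob_space.real_distribution_distr[OF measure_pmf.prob_space_axioms]) simp
  have "cdf D = emp_cdf n x"
  proof
    fix t
    have "cdf D t = measure (measure_pmf p) (x -` {..t})" by (simp add: cdf_def D_def measure_distr)
    also have "\<dots> = card ({1..n} \<inter> x -` {..t}) / real n"
      using ne by (simp add: p_def measure_pmf_of_set)
    also have "real (card ({1..n} \<inter> x -` {..t})) = (\<Sum>i = 1..n. indicator {..t} (x i))"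
      by (simp add: indicator_def Int_def vimage_def sum.If_cases)
    finally show "cdf D t = emp_cdf n x t" by (simp add: emp_cdf_def)
  qed
  moreover have "interval_measure (cdf D) = D"
  proof (rule cdf_unique)
    show "real_distribution (interval_measure (cdf D))"
      by (intro real_distribution_interval_measure D.cdf_nondecreasing D.cdf_is_right_cont
          D.cdf_lim_at_bot D.cdf_lim_at_top_prob)
    show "cdf (interval_measure (cdf D)) = cdf D"
      by (intro cdf_interval_measure D.cdf_nondecreasing D.cdf_is_right_cont D.cdf_lim_at_bot)
  qed (fact D.real_distribution_axioms)
  ultimately have eq: "interval_measure (emp_cdf n x) = D" by simp
  have meas: "(\<lambda>u. indicator {0<..} u *\<^sub>R h u) \<in> borel_measurable borel"
    using h unfolding lambda_pos_def by (subst (asm) borel_measurable_restrict_space_iff) auto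
  have "(LINT u:{0<..}|interval_measure (emp_cdf n x). h u) = (\<integral>i. indicator {0<..} (x i) *\<^sub>R h (x i) \<partial>measure_pmf p)"
    unfolding eq set_lebesgue_integral_def D_def using meas by (intro integral_distr) auto
  also have "\<dots> = (\<Sum>i = 1..n. indicator {0<..} (x i) *\<^sub>R h (x i)) / real n"
    using ne by (simp add: p_def integral_pmf_of_set)
  also have "(\<Sum>i = 1..n. indicator {0<..} (x i) *\<^sub>R h (x i)) = (\<Sum>i = 1..n. h (x i))"
    using pos by (intro sum.cong) auto
  finally show ?thesis .
qed

lemma signed_derivatives_lincomb:
  assumes v: "signed_derivatives m v" and w: "signed_derivatives m w" and ab: "0 \<le> a" "0 \<le> b"
  shows "signed_derivatives m (\<lambda>l x. a * v l x + b * w l x)"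
  unfolding signed_derivatives_def
proof (intro conjI allI impI)
  fix l and x :: real assume "l < m" "0 < x"
  then have "(v l has_real_derivative - v (Suc l) x) (at x)" "(w l has_real_derivative - w (Suc l) x) (at x)"
    using v w by (auto simp: signed_derivatives_def)
  then show "((\<lambda>x. a * v l x + b * w l x) has_real_derivative - (a * v (Suc l) x + b * w (Suc l) x)) (at x)"
    by (auto intro!: derivative_eq_intros)
next
  fix l assume l: "l \<le> m"
  then have *: "\<And>x. 0 < x \<Longrightarrow> 0 \<le> v l x" "antimono_on {0<..} (v l)" "convex_on {0<..} (v l)"
     "\<And>x. 0 < x \<Longrightarrow> 0 \<le> w l x" "antimono_on {0<..} (w l)" "convex_on {0<..} (w l)"
    using v w by (auto simp: signed_derivatives_def)
  show "0 \<le> a * v l x + b * w l x" if "0 < x" for x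
    using * that ab by simp
  show "antimono_on {0<..} (\<lambda>x. a * v l x + b * w l x)"
    using *(2,5) ab unfolding monotone_on_def by (auto intro!: add_mono mult_left_mono)
  show "convex_on {0<..} (\<lambda>x. a * v l x + b * w l x)"
    using * ab by (intro convex_on_add convex_on_cmul)
qed

lemma k_monotone_lincomb:
  assumes f: "k_monotone k f" and h: "k_monotone k h" and ab: "0 \<le> a" "0 \<le> b"
  shows "k_monotone k (\<lambda>x. a * f x + b * h x)"
proof (cases "k = 1")
  case True
  then have *: "\<And>x. 0 < x \<Longrightarrow> 0 \<le> f x" "antimono_on {0<..} f" "\<And>x. 0 < x \<Longrightarrow> 0 \<le> h x" "antimono_on {0<..} h"
    using f h by (auto simp: k_monotone_def)
  have "antimono_on {0<..} (\<lambda>x. a * f x + b * h x)"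
    using *(2,4) ab unfolding monotone_on_def by (auto intro!: add_mono mult_left_mono)
  with * ab True show ?thesis by (simp add: k_monotone_def)
next
  case False
  show ?thesis
    by (rule k_monotone_if_signed_derivatives[OF signed_derivatives_lincomb[OF
          k_monotone_signed_derivatives[OF f False] k_monotone_signed_derivatives[OF h False] ab] _ False]) simp
qed

lemma dpow_Suc: "dpow (Suc m) y = (max 0 y) ^ Suc m / fact (Suc m)"
  by (simp add: dpow_def trunc_power_def max_def)

text \<open>Only the point \<open>0\<close> needs an argument: there the difference quotient is
  a multiple of \<^term>\<open>dpow (Suc m)\<close>, which is continuous and vanishes at \<open>0\<close>.\<close>

lemma DERIV_dpow: "(dpow (Suc (Suc m)) has_real_derivative dpow (Suc m) y) (at y)"
proof (cases y "0::real" rule: linorder_cases)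
  case less
  have "((\<lambda>y::real. 0) has_real_derivative dpow (Suc m) y) (at y)" using less by (simp add: dpow_neg)
  then show ?thesis
    by (rule has_field_derivative_transform_within_open[where S = "{..<0}"]) (use less in \<open>auto simp: dpow_neg\<close>)
next
  case greater
  have "((\<lambda>y. y ^ Suc (Suc m) / fact (Suc (Suc m))) has_real_derivative y ^ Suc m / fact (Suc m)) (at y)"
    by (rule derivative_eq_intros refl | simp)+
  then have "((\<lambda>y. y ^ Suc (Suc m) / fact (Suc (Suc m))) has_real_derivative dpow (Suc m) y) (at y)"
    using greater by (simp add: dpow_def trunc_power_def)
  then show ?thesis
    by (rule has_field_derivative_transform_within_open[where S = "{0<..}"])
       (use greater in \<open>auto simp: dpow_def trunc_power_def\<close>)
next
  case equal
  have "isCont (\<lambda>h. dpow (Suc m) h / real (Suc (Suc m))) 0"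
    unfolding dpow_Suc by (intro continuous_intros) auto
  then have "((\<lambda>h. dpow (Suc m) h / real (Suc (Suc m))) \<longlongrightarrow> 0) (at 0)"
    by (simp add: isCont_def dpow_Suc)
  moreover have "\<forall>\<^sub>F h in at 0. dpow (Suc m) h / real (Suc (Suc m)) = (dpow (Suc (Suc m)) (0 + h) - dpow (Suc (Suc m)) 0) / h"
  proof (unfold eventually_at_filter, intro always_eventually allI impI)
    fix h :: real assume "h \<noteq> 0"
    have "dpow (Suc (Suc m)) h = h * dpow (Suc m) h / real (Suc (Suc m))"
      by (simp add: dpow_def trunc_power_def fact_Suc[of "Suc m"] del: fact_Suc)
    then show "dpow (Suc m) h / real (Suc (Suc m)) = (dpow (Suc (Suc m)) (0 + h) - dpow (Suc (Suc m)) 0) / h"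
      using \<open>h \<noteq> 0\<close> dpow_Suc[of "Suc m" 0] by (simp del: of_nat_Suc)
  qed
  ultimately have "((\<lambda>h. (dpow (Suc (Suc m)) (0 + h) - dpow (Suc (Suc m)) 0) / h) \<longlongrightarrow> 0) (at 0)"
    by (rule Lim_transform_eventually)
  then show ?thesis unfolding equal by (simp add: DERIV_def dpow_Suc)
qed

lemma convex_on_dpow: "convex_on A (\<lambda>x. dpow (Suc m) (t - x))" if "convex A"
proof (rule convex_onI)
  fix s x y :: real assume s: "0 < s" "s < 1"
  have cp: "convex_on {0::real..} (\<lambda>x. x ^ Suc m)"
    using convex_power_odd[of "Suc m"] convex_on_subset[OF convex_power_even[of "Suc m"], of "{0..}"] by (cases "odd (Suc m)") auto
  have "max 0 (t - ((1 - s) * x + s * y)) \<le> (1 - s) * max 0 (t - x) + s * max 0 (t - y)"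
  proof -
    have "t - ((1 - s) * x + s * y) = (1 - s) * (t - x) + s * (t - y)" by (simp add: algebra_simps)
    also have "\<dots> \<le> (1 - s) * max 0 (t - x) + s * max 0 (t - y)"
      using s by (intro add_mono mult_left_mono) auto
    finally show ?thesis using s by simp
  qed
  then have "max 0 (t - ((1 - s) * x + s * y)) ^ Suc m \<le> ((1 - s) * max 0 (t - x) + s * max 0 (t - y)) ^ Suc m"
    by (intro power_mono) auto
  also have "\<dots> \<le> (1 - s) * max 0 (t - x) ^ Suc m + s * max 0 (t - y) ^ Suc m"
    using convex_onD[OF cp, of s "max 0 (t - x)" "max 0 (t - y)"] s by simp
  finally have "max 0 (t - ((1 - s) * x + s * y)) ^ Suc m / fact (Suc m)
      \<le> ((1 - s) * max 0 (t - x) ^ Suc m + s * max 0 (t - y) ^ Suc m) / fact (Suc m)"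
    by (rule divide_right_mono) simp
  then show "dpow (Suc m) (t - ((1 - s) *\<^sub>R x + s *\<^sub>R y)) \<le> (1 - s) * dpow (Suc m) (t - x) + s * dpow (Suc m) (t - y)"
    unfolding dpow_Suc by (simp only: real_scaleR_def add_divide_distrib times_divide_eq_right)
qed (fact that)

lemma antimono_on_dpow: "antimono_on A (\<lambda>x. dpow m (t - x))"
  unfolding monotone_on_def dpow_def trunc_power_def by (auto intro!: divide_right_mono power_mono)

lemma k_monotone_dpow:
  assumes "1 \<le> k"
  shows "k_monotone k (\<lambda>x. dpow (k - 1) (t - x))"
proof (cases "k = 1")
  case True
  then show ?thesis using antimono_on_dpow by (simp add: k_monotone_def)
next
  case False
  show ?thesis
  proof (rule k_monotone_if_signed_derivatives[where v = "\<lambda>l x. dpow (k - 1 - l) (t - x)"])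
    have "((\<lambda>x. dpow (k - 1 - l) (t - x)) has_real_derivative - dpow (k - 1 - Suc l) (t - x)) (at x)"
      if l: "l < k - 2" for l x
    proof -
      obtain j where j: "k - 1 - l = Suc (Suc j)" "k - 1 - Suc l = Suc j"
      proof
        show "k - 1 - l = Suc (Suc (k - l - 3))" "k - 1 - Suc l = Suc (k - l - 3)" using l by auto
      qed
      have "((\<lambda>x. t - x) has_real_derivative - 1) (at x)" by (auto intro!: derivative_eq_intros)
      from DERIV_chain2[OF DERIV_dpow this, of j] show ?thesis unfolding j by simp
    qed
    moreover have "convex_on {0<..} (\<lambda>x. dpow (k - 1 - l) (t - x))" if l: "l \<le> k - 2" for l
    proof -
      have "k - 1 - l = Suc (k - 2 - l)" using l False assms by auto
      then show ?thesis by (simp add: convex_on_dpow)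
    qed
    ultimately show "signed_derivatives (k - 2) (\<lambda>l x. dpow (k - 1 - l) (t - x))"
      by (simp add: signed_derivatives_def antimono_on_dpow)
  qed (use False in auto)
qed

lemma dpow_kmon_L2: "1 \<le> k \<Longrightarrow> (\<lambda>x. dpow (k - 1) (t - x)) \<in> kmon_L2 k"
  using k_monotone_dpow[of k t] dpow_L2[of "k - 1" t] by (simp add: kmon_L2_def)

lemma
  assumes f: "f \<in> L2_pos" and h: "h \<in> L2_pos"
  shows lincomb_L2: "(\<lambda>x. a * f x + b * h x) \<in> L2_pos"
    and integral_lincomb_square: "(\<integral>x. (a * f x + b * h x)\<^sup>2 \<partial>lambda_pos) =
      a\<^sup>2 * (\<integral>x. (f x)\<^sup>2 \<partial>lambda_pos) + 2 * a * b * (\<integral>x. f x * h x \<partial>lambda_pos) + b\<^sup>2 * (\<integral>x. (h x)\<^sup>2 \<partial>lambda_pos)"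
proof -
  have [measurable]: "f \<in> borel_measurable lambda_pos" "h \<in> borel_measurable lambda_pos"
    and sq [simp]: "integrable lambda_pos (\<lambda>x. (f x)\<^sup>2)" "integrable lambda_pos (\<lambda>x. (h x)\<^sup>2)"
    using f h by (auto simp: L2_pos_def)
  have fh [simp]: "integrable lambda_pos (\<lambda>x. f x * h x)" by (rule integrable_mult_L2[OF f h])
  have eq: "(a * f x + b * h x)\<^sup>2 = a\<^sup>2 * (f x)\<^sup>2 + 2 * a * b * (f x * h x) + b\<^sup>2 * (h x)\<^sup>2" for x
    by (simp add: power2_eq_square algebra_simps)
  show "(\<lambda>x. a * f x + b * h x) \<in> L2_pos" unfolding L2_pos_def by (simp add: eq)
  show "(\<integral>x. (a * f x + b * h x)\<^sup>2 \<partial>lambda_pos) =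
      a\<^sup>2 * (\<integral>x. (f x)\<^sup>2 \<partial>lambda_pos) + 2 * a * b * (\<integral>x. f x * h x \<partial>lambda_pos) + b\<^sup>2 * (\<integral>x. (h x)\<^sup>2 \<partial>lambda_pos)"
    unfolding eq by simp
qed

lemma kmon_L2_lincomb:
  assumes "f \<in> kmon_L2 k" "h \<in> kmon_L2 k" "0 \<le> a" "0 \<le> b"
  shows "(\<lambda>x. a * f x + b * h x) \<in> kmon_L2 k"
  using assms by (simp add: kmon_L2_def k_monotone_lincomb lincomb_L2)

definition sample_mean :: "nat \<Rightarrow> (nat \<Rightarrow> real) \<Rightarrow> (real \<Rightarrow> real) \<Rightarrow> real" where
  "sample_mean n x h = (\<Sum>i = 1..n. h (x i)) / real n"

lemma sample_mean_lincomb: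
  "sample_mean n x (\<lambda>y. a * f y + b * h y) = a * sample_mean n x f + b * sample_mean n x h"
  by (simp add: sample_mean_def sum.distrib sum_distrib_left add_divide_distrib)

lemma ls_criterion_eq:
  assumes "1 \<le> n" "\<And>i. i \<in> {1..n} \<Longrightarrow> 0 < x i" "h \<in> L2_pos"
  shows "ls_criterion n x h = (\<integral>u. (h u)\<^sup>2 \<partial>lambda_pos) / 2 - sample_mean n x h"
  using assms integral_interval_measure_emp_cdf[of n x h]
  by (simp add: ls_criterion_def sample_mean_def L2_pos_def)

lemma linear_coeff_nonneg:
  fixes A B :: real
  assumes "\<And>\<epsilon>. 0 < \<epsilon> \<Longrightarrow> \<epsilon> < 1 \<Longrightarrow> 0 \<le> \<epsilon> * A + \<epsilon>\<^sup>2 * B"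
  shows "0 \<le> A"
proof (rule tendsto_lowerbound)
  show "((\<lambda>\<epsilon>. A + \<epsilon> * B) \<longlongrightarrow> A) (at_right 0)" by (auto intro!: tendsto_eq_intros)
  have "0 \<le> A + \<epsilon> * B" if "0 < \<epsilon>" "\<epsilon> < 1" for \<epsilon>
  proof -
    have "0 \<le> \<epsilon> * (A + \<epsilon> * B)" using assms[OF that] by (simp add: power2_eq_square algebra_simps)
    then show ?thesis using that by (simp add: zero_le_mult_iff)
  qed
  then show "\<forall>\<^sub>F \<epsilon> in at_right 0. 0 \<le> A + \<epsilon> * B"
    unfolding eventually_at_right_field by (intro exI[of _ 1]) auto
qed simp

text \<open>The gap between the criterion at \<open>a g + b h\<close> and at \<open>g\<close> is a quadratic polynomial in \<open>a\<close> and
  \<open>b\<close>. Minimality at \<open>(a, b) = (1, 0)\<close> forces its linear coefficient to be nonnegative in the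
  admissible directions: \<open>b\<close> may only grow, but \<open>a\<close> may move both ways, and the direction of
  growing \<open>a\<close> is the case \<open>h = g\<close> of the first condition.\<close>

lemma is_lse_iff_variational:
  assumes n: "1 \<le> n" and pos: "\<And>i. i \<in> {1..n} \<Longrightarrow> 0 < x i" and g: "g \<in> kmon_L2 k"
  shows "is_lse k n x g \<longleftrightarrow>
    (\<forall>h\<in>kmon_L2 k. sample_mean n x h \<le> (\<integral>u. g u * h u \<partial>lambda_pos)) \<and>
    (\<integral>u. (g u)\<^sup>2 \<partial>lambda_pos) = sample_mean n x g"
proof -
  have L2: "h \<in> L2_pos" if "h \<in> kmon_L2 k" for h using that by (simp add: kmon_L2_def)
  have ls: "ls_criterion n x h = (\<integral>u. (h u)\<^sup>2 \<partial>lambda_pos) / 2 - sample_mean n x h" if "h \<in> L2_pos" for h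
    by (rule ls_criterion_eq[OF n pos that])
  define G where "G = (\<integral>u. (g u)\<^sup>2 \<partial>lambda_pos)"
  have gap: "ls_criterion n x (\<lambda>u. a * g u + b * h u) - ls_criterion n x g =
      ((a\<^sup>2 - 1) / 2 * G - (a - 1) * sample_mean n x g) + b * (a * (\<integral>u. g u * h u \<partial>lambda_pos) - sample_mean n x h)
        + b\<^sup>2 * ((\<integral>u. (h u)\<^sup>2 \<partial>lambda_pos) / 2)"
    if "h \<in> kmon_L2 k" for h a b
    unfolding ls[OF L2[OF g]] ls[OF lincomb_L2[OF L2[OF g] L2[OF that]]]
      integral_lincomb_square[OF L2[OF g] L2[OF that]] sample_mean_lincomb G_def[symmetric]
    by (simp add: field_simps)
  show ?thesis
  proof (intro iffI conjI ballI; (elim conjE)?)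
    assume lse: "is_lse k n x g"
    then have min: "ls_criterion n x g \<le> ls_criterion n x f" if "f \<in> kmon_L2 k" for f
      using that by (force simp: is_lse_def is_arg_min_def not_less)
    show le: "sample_mean n x h \<le> (\<integral>u. g u * h u \<partial>lambda_pos)" if h: "h \<in> kmon_L2 k" for h
    proof -
      have "0 \<le> (\<integral>u. g u * h u \<partial>lambda_pos) - sample_mean n x h"
      proof (rule linear_coeff_nonneg)
        fix \<epsilon> :: real assume "0 < \<epsilon>"
        then show "0 \<le> \<epsilon> * ((\<integral>u. g u * h u \<partial>lambda_pos) - sample_mean n x h) + \<epsilon>\<^sup>2 * ((\<integral>u. (h u)\<^sup>2 \<partial>lambda_pos) / 2)"
          using gap[OF h, of 1 \<epsilon>] min[OF kmon_L2_lincomb[OF g h, of 1 \<epsilon>]] by simp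
      qed
      then show ?thesis by simp
    qed
    have "0 \<le> sample_mean n x g - G"
    proof (rule linear_coeff_nonneg)
      fix \<epsilon> :: real assume "0 < \<epsilon>" "\<epsilon> < 1"
      then have "0 \<le> ((1 - \<epsilon>)\<^sup>2 - 1) / 2 * G - ((1 - \<epsilon>) - 1) * sample_mean n x g"
        using gap[OF g, of "1 - \<epsilon>" 0] min[OF kmon_L2_lincomb[OF g g, of "1 - \<epsilon>" 0]] by simp
      also have "\<dots> = \<epsilon> * (sample_mean n x g - G) + \<epsilon>\<^sup>2 * (G / 2)"
        by (simp add: power2_eq_square field_simps)
      finally show "0 \<le> \<epsilon> * (sample_mean n x g - G) + \<epsilon>\<^sup>2 * (G / 2)" .
    qed
    then show "(\<integral>u. (g u)\<^sup>2 \<partial>lambda_pos) = sample_mean n x g"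
      using le[OF g] by (simp add: G_def power2_eq_square)
  next
    assume le: "\<forall>h\<in>kmon_L2 k. sample_mean n x h \<le> (\<integral>u. g u * h u \<partial>lambda_pos)"
      and eq: "(\<integral>u. (g u)\<^sup>2 \<partial>lambda_pos) = sample_mean n x g"
    have "ls_criterion n x g \<le> ls_criterion n x h" if h: "h \<in> kmon_L2 k" for h
    proof -
      have "0 \<le> (\<integral>u. (1 * h u + (-1) * g u)\<^sup>2 \<partial>lambda_pos)" by simp
      then have "2 * (\<integral>u. g u * h u \<partial>lambda_pos) - G \<le> (\<integral>u. (h u)\<^sup>2 \<partial>lambda_pos)"
        unfolding integral_lincomb_square[OF L2[OF h] L2[OF g]] G_def by (simp add: mult.commute)
      moreover have "sample_mean n x h \<le> (\<integral>u. g u * h u \<partial>lambda_pos)" using le h by blast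
      ultimately show ?thesis
        using eq by (simp add: ls[OF L2[OF h]] ls[OF L2[OF g]] G_def)
    qed
    then show "is_lse k n x g" using g by (force simp: is_lse_def is_arg_min_def not_less)
  qed
qed

section \<open>Pairings with truncated powers\<close>

text \<open>By Cauchy's formula, \<open>pairing (k - 1) g\<close> is the function \<open>H\<close> of the characterization and
  \<open>empirical_pairing (k - 1) n x\<close> is \<open>Y\<close>.\<close>

definition pairing :: "nat \<Rightarrow> (real \<Rightarrow> real) \<Rightarrow> real \<Rightarrow> real" where
  "pairing m g t = (\<integral>u. g u * dpow m (t - u) \<partial>lambda_pos)"

definition empirical_pairing :: "nat \<Rightarrow> nat \<Rightarrow> (nat \<Rightarrow> real) \<Rightarrow> real \<Rightarrow> real" where
  "empirical_pairing m n x t = sample_mean n x (\<lambda>u. dpow m (t - u))"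

lemma empirical_pairing_nonneg: "0 \<le> empirical_pairing m n x t"
  by (simp add: empirical_pairing_def sample_mean_def sum_nonneg)

text \<open>Pairing \<open>g\<close>, or the sample, with a mixture of truncated powers amounts to mixing the pairings.
  The measure \<open>N\<close> on the parameters is Lebesgue measure for the superposition
  of an arbitrary member of the cone, and \<open>F\<close> for \<open>g\<close> itself.\<close>

lemma nn_integral_mult_mixture:
  assumes "sigma_finite_measure N" and g: "g \<in> L2_pos" "\<And>x. 0 < x \<Longrightarrow> 0 \<le> g x"
    and [measurable]: "T \<in> borel_measurable N" "c \<in> borel_measurable N"
  shows "(\<integral>\<^sup>+u. ennreal (g u) * (\<integral>\<^sup>+s. c s * ennreal (dpow m (T s - u)) \<partial>N) \<partial>lambda_pos)
       = (\<integral>\<^sup>+s. c s * ennreal (pairing m g (T s)) \<partial>N)"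
proof -
  interpret N: sigma_finite_measure N by fact
  interpret pair_sigma_finite N lambda_pos ..
  have [measurable]: "g \<in> borel_measurable lambda_pos" using g by (simp add: L2_pos_def)
  have "(\<integral>\<^sup>+u. ennreal (g u) * (\<integral>\<^sup>+s. c s * ennreal (dpow m (T s - u)) \<partial>N) \<partial>lambda_pos)
      = (\<integral>\<^sup>+u. (\<integral>\<^sup>+s. c s * (ennreal (g u) * ennreal (dpow m (T s - u))) \<partial>N) \<partial>lambda_pos)"
    by (intro nn_integral_cong) (simp add: nn_integral_cmult[symmetric] mult.left_commute)
  also have "\<dots> = (\<integral>\<^sup>+s. (\<integral>\<^sup>+u. c s * (ennreal (g u) * ennreal (dpow m (T s - u))) \<partial>lambda_pos) \<partial>N)"
    by (rule Fubini') measurable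
  also have "\<dots> = (\<integral>\<^sup>+s. c s * ennreal (pairing m g (T s)) \<partial>N)"
    by (simp add: nn_integral_cmult nn_integral_dpow_L2[OF g] pairing_def)
  finally show ?thesis .
qed

lemma ennreal_sample_mean:
  assumes "\<And>i. i \<in> {1..n} \<Longrightarrow> 0 \<le> h (x i)"
  shows "ennreal (sample_mean n x h) = (\<Sum>i = 1..n. ennreal (h (x i))) * ennreal (1 / real n)"
proof -
  have "ennreal (sample_mean n x h) = ennreal ((\<Sum>i = 1..n. h (x i)) * (1 / real n))"
    by (simp add: sample_mean_def)
  also have "\<dots> = ennreal (\<Sum>i = 1..n. h (x i)) * ennreal (1 / real n)"
    by (rule ennreal_mult) (auto intro!: sum_nonneg assms)
  finally show ?thesis using assms by (subst sum_ennreal) auto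
qed

lemma sample_mean_mixture:
  assumes [measurable]: "T \<in> borel_measurable N" "c \<in> borel_measurable N"
  shows "(\<Sum>i = 1..n. \<integral>\<^sup>+s. c s * ennreal (dpow m (T s - x i)) \<partial>N) * ennreal (1 / real n)
       = (\<integral>\<^sup>+s. c s * ennreal (empirical_pairing m n x (T s)) \<partial>N)"
proof -
  have mean: "ennreal (empirical_pairing m n x t) = (\<Sum>i = 1..n. ennreal (dpow m (t - x i))) * ennreal (1 / real n)" for t
    unfolding empirical_pairing_def by (rule ennreal_sample_mean) simp
  have meas: "(\<lambda>s. c s * ennreal (dpow m (T s - y))) \<in> borel_measurable N" for y by measurable
  have "(\<Sum>i = 1..n. \<integral>\<^sup>+s. c s * ennreal (dpow m (T s - x i)) \<partial>N) * ennreal (1 / real n)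
      = (\<integral>\<^sup>+s. (\<Sum>i = 1..n. c s * ennreal (dpow m (T s - x i))) * ennreal (1 / real n) \<partial>N)"
    using meas by (simp add: nn_integral_sum nn_integral_multc)
  then show ?thesis unfolding mean by (simp only: sum_distrib_left mult.assoc[symmetric])
qed

text \<open>Decompose \<open>h\<close> into truncated powers, compare the two pairings level by level, and reassemble.
  The superposition dominates \<open>h\<close> at the observations, where equality almost everywhere would
  be of no use.\<close>

lemma sample_mean_le_if_pairing_le:
  assumes k: "1 \<le> k" and pos: "\<And>i. i \<in> {1..n} \<Longrightarrow> 0 < x i"
    and g: "g \<in> kmon_L2 k" and h: "h \<in> kmon_L2 k"
    and le: "\<And>t. empirical_pairing (k - 1) n x t \<le> pairing (k - 1) g t"
  shows "sample_mean n x h \<le> (\<integral>u. g u * h u \<partial>lambda_pos)"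
proof -
  have L2: "g \<in> L2_pos" "h \<in> L2_pos" and km: "k_monotone k g" "k_monotone k h"
    using g h by (auto simp: kmon_L2_def)
  note nn = k_monotone_nonneg_antimono(1)[OF k km(1)] k_monotone_nonneg_antimono(1)[OF k km(2)]
  have "(h \<longlongrightarrow> 0) at_top"
    by (rule L2_antimono_tendsto_0[OF nn(2) k_monotone_nonneg_antimono(2)[OF k km(2)] L2(2)])
  then obtain T where T_meas [measurable]: "T \<in> borel_measurable borel"
    and T_ge: "\<And>x. 0 < x \<Longrightarrow> ennreal (h x) \<le> superposition (k - 1) T x"
    and T_eq: "AE x in lborel. 0 < x \<longrightarrow> ennreal (h x) = superposition (k - 1) T x"
    using k_monotone_superposition[OF k km(2)] by blast
  define c :: "real \<Rightarrow> ennreal" where "c = indicator {0<..}"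
  have c_meas [measurable]: "c \<in> borel_measurable borel" by (simp add: c_def)
  have sup: "superposition (k - 1) T u = (\<integral>\<^sup>+s. c s * ennreal (dpow (k - 1) (T s - u)) \<partial>lborel)" for u
    by (simp add: superposition_def c_def mult.commute)
  have T_eq': "AE u in lambda_pos. ennreal (h u) = superposition (k - 1) T u"
    unfolding lambda_pos_def using T_eq by (subst AE_restrict_space_iff) auto
  have "ennreal (sample_mean n x h) = (\<Sum>i = 1..n. ennreal (h (x i))) * ennreal (1 / real n)"
    using nn(2) pos by (intro ennreal_sample_mean) auto
  also have "\<dots> \<le> (\<Sum>i = 1..n. superposition (k - 1) T (x i)) * ennreal (1 / real n)"
    using T_ge pos by (intro mult_right_mono sum_mono) auto
  also have "\<dots> = (\<integral>\<^sup>+s. c s * ennreal (empirical_pairing (k - 1) n x (T s)) \<partial>lborel)"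
    unfolding sup by (rule sample_mean_mixture) (simp_all add: T_meas c_meas)
  also have "\<dots> \<le> (\<integral>\<^sup>+s. c s * ennreal (pairing (k - 1) g (T s)) \<partial>lborel)"
    by (intro nn_integral_mono mult_left_mono ennreal_leI le) auto
  also have "\<dots> = (\<integral>\<^sup>+u. ennreal (g u) * superposition (k - 1) T u \<partial>lambda_pos)"
    unfolding sup
    by (rule nn_integral_mult_mixture[OF lborel.sigma_finite_measure_axioms L2(1) nn(1), symmetric]) (simp_all add: T_meas c_meas)
  also have "\<dots> = (\<integral>\<^sup>+u. ennreal (g u * h u) \<partial>lambda_pos)"
  proof (rule nn_integral_cong_AE)
    show "AE u in lambda_pos. ennreal (g u) * superposition (k - 1) T u = ennreal (g u * h u)"
      using T_eq' AE_space
    proof eventually_elim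
      case (elim u)
      then show ?case using nn[of u] by (simp add: ennreal_mult flip: elim(1))
    qed
  qed
  also have "\<dots> = ennreal (\<integral>u. g u * h u \<partial>lambda_pos)"
    using nn by (intro nn_integral_eq_integral integrable_mult_L2 L2 AE_I2) simp
  finally show ?thesis
    using nn by (subst (asm) ennreal_le_iff) (auto intro!: integral_nonneg_AE AE_I2)
qed

section \<open>Contact set and support\<close>

lemma isCont_dpow: "y \<noteq> 0 \<Longrightarrow> isCont (dpow m) y"
proof (cases "0 < y")
  case True
  have "isCont (\<lambda>y. y ^ m / fact m) y" by (intro continuous_intros) auto
  moreover have "\<forall>\<^sub>F y in nhds y. dpow m y = y ^ m / fact m"
    using eventually_nhds_in_open[of "{0<..}" y] True
    by (auto simp: dpow_def trunc_power_def elim!: eventually_mono)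
  ultimately show ?thesis by (simp add: isCont_cong)
next
  case False
  assume "y \<noteq> 0"
  with False have "y < 0" by simp
  then have "\<forall>\<^sub>F y in nhds y. dpow m y = 0"
    using eventually_nhds_in_open[of "{..<0}" y] by (auto simp: dpow_neg elim!: eventually_mono)
  then show ?thesis by (simp add: isCont_cong)
qed

lemma dpow_mono: "y \<le> z \<Longrightarrow> dpow m y \<le> dpow m z"
  by (auto simp: dpow_def trunc_power_def intro!: divide_right_mono power_mono)

text \<open>Dominated convergence; for exponent \<open>0\<close> the integrands converge only off the single point
  \<open>x = t\<close>.\<close>

lemma isCont_pairing:
  assumes g: "g \<in> L2_pos" "\<And>x. 0 < x \<Longrightarrow> 0 \<le> g x"
  shows "isCont (pairing m g) t"
proof (rule continuous_at_sequentiallyI)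
  fix u assume u: "u \<longlonglongrightarrow> t"
  then obtain B where B: "\<And>j. \<bar>u j\<bar> \<le> B"
    using convergent_imp_Bseq[of u] by (auto simp: convergent_def Bseq_def)
  have [measurable]: "g \<in> borel_measurable lambda_pos" using g by (simp add: L2_pos_def)
  show "(\<lambda>j. pairing m g (u j)) \<longlonglongrightarrow> pairing m g t"
    unfolding pairing_def
  proof (rule integral_dominated_convergence[where w = "\<lambda>x. g x * dpow m (B - x)"])
    show "integrable lambda_pos (\<lambda>x. g x * dpow m (B - x))" by (intro integrable_mult_L2 g dpow_L2)
    have "AE x in lambda_pos. x \<noteq> t"
      unfolding lambda_pos_def using AE_lborel_singleton[of t]
      by (subst AE_restrict_space_iff) auto
    then show "AE x in lambda_pos. (\<lambda>j. g x * dpow m (u j - x)) \<longlonglongrightarrow> g x * dpow m (t - x)"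
    proof eventually_elim
      case (elim x)
      then have "isCont (dpow m) (t - x)" by (intro isCont_dpow) simp
      then show ?case by (intro tendsto_intros isCont_tendsto_compose[of _ "dpow m"] u)
    qed
    show "AE x in lambda_pos. norm (g x * dpow m (u j - x)) \<le> g x * dpow m (B - x)" for j
    proof (rule AE_I2)
      fix x assume "x \<in> space lambda_pos"
      then have "0 \<le> g x" using g(2) by simp
      moreover have "u j - x \<le> B - x" using B[of j] by simp
      ultimately show "norm (g x * dpow m (u j - x)) \<le> g x * dpow m (B - x)"
        by (simp add: abs_mult mult_left_mono dpow_mono)
    qed
  qed measurable
qed

text \<open>The only discontinuity is the jump for \<open>m = 0\<close>, and there the larger of the two one-sided
  limits is attained.\<close>

lemma dpow_upper_semicontinuous:
  assumes "0 < e"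
  shows "\<forall>\<^sub>F t in nhds t0. dpow m (t - a) < dpow m (t0 - a) + e"
proof (cases "m = 0 \<and> t0 = a")
  case True
  then show ?thesis using assms by (simp add: dpow_0)
next
  case False
  have "isCont (dpow m) (t0 - a)"
  proof (cases m)
    case 0
    then show ?thesis using False by (intro isCont_dpow) simp
  next
    case (Suc j)
    have "isCont (dpow (Suc j)) y" for y
      unfolding dpow_Suc[abs_def] by (intro continuous_intros) auto
    with Suc show ?thesis by simp
  qed
  moreover have "isCont (\<lambda>t. t - a) t0" by (intro continuous_intros)
  ultimately have "isCont (\<lambda>t. dpow m (t - a)) t0" by (rule isCont_o2[rotated])
  then have "((\<lambda>t. dpow m (t - a)) \<longlongrightarrow> dpow m (t0 - a)) (nhds t0)"
    using tendsto_at_iff_tendsto_nhds[of "\<lambda>t. dpow m (t - a)" t0] by (simp only: isCont_def)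
  then show ?thesis by (rule order_tendstoD) (use assms in simp)
qed

lemma empirical_pairing_upper_semicontinuous:
  assumes "0 < e"
  shows "\<forall>\<^sub>F t in nhds t0. empirical_pairing m n x t \<le> empirical_pairing m n x t0 + e"
proof -
  have "\<forall>\<^sub>F t in nhds t0. \<forall>i\<in>{1..n}. dpow m (t - x i) < dpow m (t0 - x i) + e"
    by (intro eventually_ball_finite ballI dpow_upper_semicontinuous assms) auto
  then show ?thesis
  proof eventually_elim
    case (elim t)
    have "(\<Sum>i = 1..n. dpow m (t - x i)) \<le> (\<Sum>i = 1..n. dpow m (t0 - x i) + e)"
      using elim by (intro sum_mono less_imp_le) blast
    then have "(\<Sum>i = 1..n. dpow m (t - x i)) / real n \<le> (\<Sum>i = 1..n. dpow m (t0 - x i) + e) / real n"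
      by (rule divide_right_mono) simp
    also have "\<dots> \<le> (\<Sum>i = 1..n. dpow m (t0 - x i)) / real n + e"
      using assms by (cases "n = 0") (auto simp: sum.distrib add_divide_distrib)
    finally show ?case by (simp add: empirical_pairing_def sample_mean_def)
  qed
qed

lemma open_strict_pairing:
  assumes g: "g \<in> L2_pos" "\<And>x. 0 < x \<Longrightarrow> 0 \<le> g x"
  shows "open {t. 0 < t \<and> empirical_pairing m n x t < pairing m g t}"
proof (subst open_subopen, intro ballI)
  fix t0 assume "t0 \<in> {t. 0 < t \<and> empirical_pairing m n x t < pairing m g t}"
  then have t0: "0 < t0" "empirical_pairing m n x t0 < pairing m g t0" by auto
  define e where "e = (pairing m g t0 - empirical_pairing m n x t0) / 2"
  have e: "0 < e" using t0 by (simp add: e_def)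
  have "(pairing m g \<longlongrightarrow> pairing m g t0) (nhds t0)"
    using isCont_pairing[OF g] tendsto_at_iff_tendsto_nhds[of "pairing m g" t0] by (simp only: isCont_def)
  then have "\<forall>\<^sub>F t in nhds t0. pairing m g t0 - e < pairing m g t"
    by (rule order_tendstoD) (use e in simp)
  moreover note empirical_pairing_upper_semicontinuous[OF e, of m n x t0]
  moreover have "\<forall>\<^sub>F t in nhds t0. t \<in> {0<..}"
    by (rule eventually_nhds_in_open) (use t0 in auto)
  ultimately have "\<forall>\<^sub>F t in nhds t0. t \<in> {t. 0 < t \<and> empirical_pairing m n x t < pairing m g t}"
    by eventually_elim (auto simp: e_def field_simps)
  then show "\<exists>S. open S \<and> t0 \<in> S \<and> S \<subseteq> {t. 0 < t \<and> empirical_pairing m n x t < pairing m g t}"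
    unfolding eventually_nhds by blast
qed

text \<open>If \<open>U\<close> misses the support, every point of \<open>U\<close> has a null neighbourhood, and countably many of
  these cover \<open>U\<close> by the Lindelof property.\<close>

lemma emeasure_open_eq_0_iff_disjoint_supp:
  assumes F: "sets F = sets (restrict_space borel {0<..})" and U: "open U" "U \<subseteq> {0<..}"
  shows "emeasure F U = 0 \<longleftrightarrow> U \<inter> measure_supp F = {}"
proof
  assume null: "emeasure F U = 0"
  have eq: "U \<inter> {0<..} = U" using U by auto
  have "t \<notin> measure_supp F" if "t \<in> U" for t
  proof
    assume "t \<in> measure_supp F"
    then have "0 < emeasure F (U \<inter> {0<..})" using that U(1) unfolding measure_supp_def by blast
    then show False using null by (simp add: eq)
  qed
  then show "U \<inter> measure_supp F = {}" by blast
next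
  assume disj: "U \<inter> measure_supp F = {}"
  define \<V> where "\<V> = {V. open V \<and> V \<subseteq> U \<and> emeasure F V = 0}"
  have setsF: "V \<in> sets F" if "open V" "V \<subseteq> U" for V
    unfolding F using that U by (auto simp: sets_restrict_space_iff)
  have "\<Union>\<V> = U"
  proof
    show "U \<subseteq> \<Union>\<V>"
    proof
      fix t assume t: "t \<in> U"
      then have "t \<notin> measure_supp F" "0 < t" using disj U by auto
      then obtain V where V: "open V" "t \<in> V" "emeasure F (V \<inter> {0<..}) = 0"
        unfolding measure_supp_def mem_Collect_eq zero_less_iff_neq_zero by blast
      have "V \<inter> {0<..} \<in> sets F"
        unfolding F using V by (auto simp: sets_restrict_space_iff)
      moreover have "V \<inter> U \<subseteq> V \<inter> {0<..}" using U by auto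
      ultimately have "emeasure F (V \<inter> U) = 0"
        using emeasure_mono[of "V \<inter> U" "V \<inter> {0<..}" F] V(3) by simp
      then have "V \<inter> U \<in> \<V>" using V U by (auto simp: \<V>_def)
      then show "t \<in> \<Union>\<V>" using V t by blast
    qed
  qed (auto simp: \<V>_def)
  moreover obtain \<W> where \<W>: "\<W> \<subseteq> \<V>" "countable \<W>" "\<Union>\<W> = \<Union>\<V>"
    using Lindelof[of \<V>] by (auto simp: \<V>_def)
  moreover have "(\<Union>V\<in>\<W>. V) \<in> null_sets F"
    using \<W> by (intro null_sets_UN') (auto simp: \<V>_def null_sets_def intro!: setsF)
  ultimately show "emeasure F U = 0" by (simp add: null_sets_def)
qed

lemma mixing_measure_dpow:
  assumes "1 \<le> k" "mixing_measure k g F" "0 < x"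
  shows "ennreal (g x) = (\<integral>\<^sup>+t. ennreal (fact k / t ^ k) * ennreal (dpow (k - 1) (t - x)) \<partial>F)"
proof -
  have F: "sets F = sets (restrict_space borel {0<..})" using assms(2) by (simp add: mixing_measure_def)
  have sp: "space F = {0<..}" using sets_eq_imp_space_eq[OF F] by (simp add: space_restrict_space)
  have "ennreal (g x) = (\<integral>\<^sup>+t. ennreal (real k * trunc_power (t - x) (k - 1) / t ^ k) \<partial>F)"
    using assms by (simp add: mixing_measure_def)
  also have "\<dots> = (\<integral>\<^sup>+t. ennreal (fact k / t ^ k) * ennreal (dpow (k - 1) (t - x)) \<partial>F)"
  proof (rule nn_integral_cong)
    fix t assume "t \<in> space F"
    then have "0 < t" by (simp add: sp)
    have "real k * trunc_power (t - x) (k - 1) / t ^ k = fact k / t ^ k * dpow (k - 1) (t - x)"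
      using \<open>1 \<le> k\<close> by (cases k) (simp_all add: dpow_def)
    then show "ennreal (real k * trunc_power (t - x) (k - 1) / t ^ k)
        = ennreal (fact k / t ^ k) * ennreal (dpow (k - 1) (t - x))"
      using \<open>0 < t\<close> by (simp only:) (intro ennreal_mult, simp_all)
  qed
  finally show ?thesis .
qed

text \<open>On \<open>{a..b}\<close> the mixing kernel at \<open>x = a / 2\<close> is bounded below by a positive constant, while the
  mixture \<open>g (a / 2)\<close> is finite.\<close>

lemma mixing_measure_sigma_finite:
  assumes k: "1 \<le> k" and mix: "mixing_measure k g F"
  shows "sigma_finite_measure F"
proof
  have F: "sets F = sets (restrict_space borel {0<..})" using mix by (simp add: mixing_measure_def)
  have sp: "space F = {0<..}" using sets_eq_imp_space_eq[OF F] by (simp add: space_restrict_space)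
  have setsF: "{a..b} \<in> sets F" if "0 < a" for a b :: real
    unfolding F using that by (auto simp: sets_restrict_space_iff)
  have fin: "emeasure F {a..b} < \<infinity>" if ab: "0 < a" "a \<le> b" for a b :: real
  proof -
    \<comment> \<open>The weight is smallest at \<open>t = b\<close>, the truncated power at \<open>t = a\<close>.\<close>
    define \<delta> where "\<delta> = fact k / b ^ k * dpow (k - 1) (a / 2)"
    have \<delta>: "0 < \<delta>" using ab by (simp add: \<delta>_def dpow_def trunc_power_def)
    have "ennreal \<delta> * emeasure F {a..b} = (\<integral>\<^sup>+t. ennreal \<delta> * indicator {a..b} t \<partial>F)"
      using ab by (simp add: nn_integral_cmult_indicator setsF)
    also have "\<dots> \<le> (\<integral>\<^sup>+t. ennreal (fact k / t ^ k) * ennreal (dpow (k - 1) (t - a / 2)) \<partial>F)"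
    proof (rule nn_integral_mono)
      fix t assume "t \<in> space F"
      then have "0 < t" by (simp add: sp)
      show "ennreal \<delta> * indicator {a..b} t \<le> ennreal (fact k / t ^ k) * ennreal (dpow (k - 1) (t - a / 2))"
      proof (cases "t \<in> {a..b}")
        case True
        have "\<delta> \<le> fact k / t ^ k * dpow (k - 1) (t - a / 2)"
          unfolding \<delta>_def using True ab \<open>0 < t\<close>
          by (intro mult_mono divide_left_mono power_mono dpow_mono) auto
        then show ?thesis using True \<open>0 < t\<close> by (simp add: ennreal_mult'[symmetric] ennreal_leI)
      qed simp
    qed
    also have "\<dots> = ennreal (g (a / 2))"
      using ab by (intro mixing_measure_dpow[OF k mix, symmetric]) simp
    finally have "ennreal \<delta> * emeasure F {a..b} < \<infinity>" using ennreal_less_top le_less_trans by fastforce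
    then show ?thesis using \<delta> by (auto simp: ennreal_mult_less_top)
  qed
  show "\<exists>A. countable A \<and> A \<subseteq> sets F \<and> \<Union>A = space F \<and> (\<forall>a\<in>A. emeasure F a \<noteq> \<infinity>)"
  proof (intro exI conjI ballI)
    let ?A = "range (\<lambda>j. {inverse (real (Suc j))..real (Suc j)})"
    show "countable ?A" by simp
    show "?A \<subseteq> sets F" using setsF by auto
    show "\<Union>?A = space F"
    proof
      show "\<Union>?A \<subseteq> space F" by (auto simp: sp intro: less_le_trans[rotated])
      show "space F \<subseteq> \<Union>?A"
      proof
        fix t assume "t \<in> space F"
        then have t: "0 < t" by (simp add: sp)
        obtain p where p: "inverse (real (Suc p)) < t" using reals_Archimedean[OF t] by blast
        obtain q where q: "t \<le> real q" using real_arch_simple by blast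
        have "inverse (real (Suc (max p q))) \<le> inverse (real (Suc p))" by (intro le_imp_inverse_le) auto
        then have "inverse (real (Suc (max p q))) \<le> t" using p by linarith
        moreover have "t \<le> real (Suc (max p q))" using q by simp
        ultimately have "t \<in> {inverse (real (Suc (max p q)))..real (Suc (max p q))}" by (simp only: atLeastAtMost_iff)
        then show "t \<in> \<Union>?A" by blast
      qed
    qed
    fix a assume "a \<in> ?A"
    then obtain j where j: "a = {inverse (real (Suc j))..real (Suc j)}" by blast
    have "inverse (real (Suc j)) \<le> 1" using le_imp_inverse_le[of 1 "real (Suc j)"] by simp
    then have "inverse (real (Suc j)) \<le> real (Suc j)" by linarith
    then show "emeasure F a \<noteq> \<infinity>" unfolding j using fin[of "inverse (real (Suc j))" "real (Suc j)"] by simp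
  qed
qed

lemma nn_integral_eq_iff_AE:
  assumes [measurable]: "f \<in> borel_measurable M" "f' \<in> borel_measurable M"
    and le: "\<And>x. x \<in> space M \<Longrightarrow> f x \<le> f' x" and fin: "(\<integral>\<^sup>+x. f x \<partial>M) \<noteq> \<infinity>"
  shows "(\<integral>\<^sup>+x. f x \<partial>M) = (\<integral>\<^sup>+x. f' x \<partial>M) \<longleftrightarrow> (AE x in M. f x = (f' x :: ennreal))"
proof
  assume eq: "(\<integral>\<^sup>+x. f x \<partial>M) = (\<integral>\<^sup>+x. f' x \<partial>M)"
  have "(\<integral>\<^sup>+x. f' x - f x \<partial>M) = (\<integral>\<^sup>+x. f' x \<partial>M) - (\<integral>\<^sup>+x. f x \<partial>M)"
    using le by (intro nn_integral_diff fin AE_I2) auto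
  also have "\<dots> = 0" using eq fin by simp
  finally have "AE x in M. f' x - f x = 0" by (subst (asm) nn_integral_0_iff_AE) auto
  then show "AE x in M. f x = f' x"
    using AE_space
  proof eventually_elim
    case (elim x)
    then show ?case using le[of x] by (simp add: diff_eq_0_iff_ennreal antisym)
  qed
qed (rule nn_integral_cong_AE)

text \<open>Both sides of the equation are integrals with respect to \<open>F\<close> with the same positive weight, one
  of \<open>H\<close> and one of \<open>Y\<close>, so that equality under \<open>Y \<le> H\<close> means \<open>H = Y\<close> almost everywhere.
  The exceptional set is open, hence null exactly when it misses the support.\<close>

lemma square_integral_eq_sample_mean_iff:
  assumes k: "1 \<le> k" and pos: "\<And>i. i \<in> {1..n} \<Longrightarrow> 0 < x i"
    and g: "g \<in> kmon_L2 k" and mix: "mixing_measure k g F"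
    and le: "\<And>t. empirical_pairing (k - 1) n x t \<le> pairing (k - 1) g t"
  shows "(\<integral>u. (g u)\<^sup>2 \<partial>lambda_pos) = sample_mean n x g \<longleftrightarrow>
    (\<forall>t\<in>measure_supp F. pairing (k - 1) g t = empirical_pairing (k - 1) n x t)"
proof -
  have L2: "g \<in> L2_pos" and km: "k_monotone k g" using g by (auto simp: kmon_L2_def)
  note nn = k_monotone_nonneg_antimono(1)[OF k km]
  have F: "sets F = sets (restrict_space borel {0<..})" using mix by (simp add: mixing_measure_def)
  have sp: "space F = {0<..}" using sets_eq_imp_space_eq[OF F] by (simp add: space_restrict_space)
  have [measurable]: "(\<lambda>t. t) \<in> borel_measurable F"
    unfolding measurable_cong_sets[OF F refl] by (rule measurable_restrict_space1) simp
  define c where "c t = ennreal (fact k / t ^ k)" for t :: real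
  have [measurable]: "c \<in> borel_measurable F" unfolding c_def by measurable
  have gmix: "ennreal (g u) = (\<integral>\<^sup>+t. c t * ennreal (dpow (k - 1) (t - u)) \<partial>F)" if "0 < u" for u
    unfolding c_def by (rule mixing_measure_dpow[OF k mix that])
  have "continuous_on UNIV (pairing (k - 1) g)"
    using isCont_pairing[OF L2 nn] by (simp add: continuous_at_imp_continuous_on)
  then have [measurable]: "pairing (k - 1) g \<in> borel_measurable borel" by (rule borel_measurable_continuous_onI)
  have [measurable]: "empirical_pairing (k - 1) n x \<in> borel_measurable borel"
    unfolding empirical_pairing_def sample_mean_def by measurable
  have sq: "ennreal (\<integral>u. (g u)\<^sup>2 \<partial>lambda_pos) = (\<integral>\<^sup>+t. c t * ennreal (pairing (k - 1) g t) \<partial>F)"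
  proof -
    have "ennreal (\<integral>u. (g u)\<^sup>2 \<partial>lambda_pos) = (\<integral>\<^sup>+u. ennreal ((g u)\<^sup>2) \<partial>lambda_pos)"
      using L2 by (intro nn_integral_eq_integral[symmetric]) (auto simp: L2_pos_def)
    also have "\<dots> = (\<integral>\<^sup>+u. ennreal (g u) * (\<integral>\<^sup>+t. c t * ennreal (dpow (k - 1) (t - u)) \<partial>F) \<partial>lambda_pos)"
    proof (rule nn_integral_cong)
      fix u assume "u \<in> space lambda_pos"
      then have "0 < u" by simp
      then show "ennreal ((g u)\<^sup>2) = ennreal (g u) * (\<integral>\<^sup>+t. c t * ennreal (dpow (k - 1) (t - u)) \<partial>F)"
        unfolding gmix[OF \<open>0 < u\<close>, symmetric] using nn[of u] by (simp add: power2_eq_square ennreal_mult)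
    qed
    also have "\<dots> = (\<integral>\<^sup>+t. c t * ennreal (pairing (k - 1) g t) \<partial>F)"
      by (rule nn_integral_mult_mixture[OF mixing_measure_sigma_finite[OF k mix] L2 nn]) measurable
    finally show ?thesis .
  qed
  have sm: "ennreal (sample_mean n x g) = (\<integral>\<^sup>+t. c t * ennreal (empirical_pairing (k - 1) n x t) \<partial>F)"
  proof -
    have "ennreal (sample_mean n x g) = (\<Sum>i = 1..n. ennreal (g (x i))) * ennreal (1 / real n)"
      using nn pos by (intro ennreal_sample_mean) auto
    also have "\<dots> = (\<Sum>i = 1..n. \<integral>\<^sup>+t. c t * ennreal (dpow (k - 1) (t - x i)) \<partial>F) * ennreal (1 / real n)"
      by (intro arg_cong[where f = "\<lambda>z. z * ennreal (1 / real n)"] sum.cong gmix pos refl)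
    also have "\<dots> = (\<integral>\<^sup>+t. c t * ennreal (empirical_pairing (k - 1) n x t) \<partial>F)"
      by (rule sample_mean_mixture) measurable
    finally show ?thesis .
  qed
  define U where "U = {t. 0 < t \<and> empirical_pairing (k - 1) n x t < pairing (k - 1) g t}"
  have U: "open U" "U \<subseteq> {0<..}" using open_strict_pairing[OF L2 nn] by (auto simp: U_def)
  have "(\<integral>u. (g u)\<^sup>2 \<partial>lambda_pos) = sample_mean n x g \<longleftrightarrow>
      ennreal (sample_mean n x g) = ennreal (\<integral>u. (g u)\<^sup>2 \<partial>lambda_pos)"
    using nn pos by (subst ennreal_inj) (auto simp: sample_mean_def intro!: divide_nonneg_nonneg sum_nonneg)
  also have "\<dots> \<longleftrightarrow> (AE t in F. c t * ennreal (empirical_pairing (k - 1) n x t) = c t * ennreal (pairing (k - 1) g t))"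
    unfolding sq sm
  proof (rule nn_integral_eq_iff_AE)
    show "c t * ennreal (empirical_pairing (k - 1) n x t) \<le> c t * ennreal (pairing (k - 1) g t)" for t
      by (intro mult_left_mono ennreal_leI le) simp
    show "(\<integral>\<^sup>+t. c t * ennreal (empirical_pairing (k - 1) n x t) \<partial>F) \<noteq> \<infinity>"
      unfolding sm[symmetric] by simp
  qed measurable
  also have "\<dots> \<longleftrightarrow> (AE t in F. t \<notin> U)"
  proof (rule AE_cong)
    fix t assume "t \<in> space F"
    then have "0 < t" by (simp add: sp)
    then have "c t \<noteq> 0" "c t \<noteq> \<infinity>" by (auto simp: c_def)
    then show "c t * ennreal (empirical_pairing (k - 1) n x t) = c t * ennreal (pairing (k - 1) g t) \<longleftrightarrow> t \<notin> U"
      using \<open>0 < t\<close> le[of t] empirical_pairing_nonneg[of "k - 1" n x t]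
      by (auto simp: U_def ennreal_mult_cancel_left)
  qed
  also have "\<dots> \<longleftrightarrow> emeasure F U = 0"
  proof (rule AE_iff_measurable[where P = "\<lambda>t. t \<notin> U"])
    show "U \<in> sets F" unfolding F using U by (auto simp: sets_restrict_space_iff)
    show "{t \<in> space F. \<not> t \<notin> U} = U" using U by (auto simp: sp)
  qed
  also have "\<dots> \<longleftrightarrow> U \<inter> measure_supp F = {}"
    by (rule emeasure_open_eq_0_iff_disjoint_supp[OF F U])
  also have "\<dots> \<longleftrightarrow> (\<forall>t\<in>measure_supp F. pairing (k - 1) g t = empirical_pairing (k - 1) n x t)"
  proof -
    have "t \<in> U \<longleftrightarrow> pairing (k - 1) g t \<noteq> empirical_pairing (k - 1) n x t" if "t \<in> measure_supp F" for t
    proof -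
      have "0 < t" using that unfolding measure_supp_def by blast
      then show ?thesis using le[of t] unfolding U_def by auto
    qed
    then show ?thesis by blast
  qed
  finally show ?thesis .
qed

section \<open>Characterization of the least squares estimator\<close>

theorem proposition2p2:
  fixes k n :: nat
    and M :: "'a measure"
    and X :: "nat \<Rightarrow> 'a \<Rightarrow> real"
    and g0 g :: "real \<Rightarrow> real"
    and F :: "real measure"
    and \<omega> :: 'a
  assumes "k \<ge> 1" and "n \<ge> 1"
    and "prob_space M"
    and "k_monotone k g0"
    and "prob_space.indep_vars M (\<lambda>_. lambda_pos) X {1..n}"
    and "\<And>i. i \<in> {1..n} \<Longrightarrow> distributed M lambda_pos (X i) (\<lambda>x. ennreal (g0 x))"
    and "\<omega> \<in> space M"
    and "g \<in> kmon_L2 k"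
    and "mixing_measure k g F"
  shows "is_lse k n (\<lambda>i. X i \<omega>) g \<longleftrightarrow>
     (\<forall>t\<ge>0. H_process k g t \<ge> Y_process k n (\<lambda>i. X i \<omega>) t) \<and>
     (\<forall>t\<in>measure_supp F. H_process k g t = Y_process k n (\<lambda>i. X i \<omega>) t)"
proof -
  define x where "x i = X i \<omega>" for i
  have pos: "0 < x i" if "i \<in> {1..n}" for i
    using measurable_space[OF distributed_measurable[OF assms(6)[OF that]] assms(7)]
    by (simp add: x_def)
  have L2: "g \<in> L2_pos" and km: "k_monotone k g" using assms(8) by (auto simp: kmon_L2_def)
  note nn = k_monotone_nonneg_antimono(1)[OF assms(1) km]
  have H: "H_process k g = pairing (k - 1) g"
    using iter_integral_L2[OF L2 nn, of "k - 1"] assms(1)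
    by (simp add: H_process_def pairing_def fun_eq_iff)
  have Y: "Y_process k n x = empirical_pairing (k - 1) n x"
    unfolding Y_process_def empirical_pairing_def sample_mean_def
    by (intro ext iter_integral_emp_cdf pos)
  have neg: "empirical_pairing (k - 1) n x t \<le> pairing (k - 1) g t" if "t < 0" for t
  proof -
    have "empirical_pairing (k - 1) n x t = 0"
      using that pos by (force simp: empirical_pairing_def sample_mean_def intro!: sum.neutral dpow_neg)
    moreover have "0 \<le> pairing (k - 1) g t"
      unfolding pairing_def using nn by (intro integral_nonneg_AE AE_I2) simp
    ultimately show ?thesis by simp
  qed
  let ?above = "\<forall>t\<ge>0. empirical_pairing (k - 1) n x t \<le> pairing (k - 1) g t"
  have above: "(\<forall>h\<in>kmon_L2 k. sample_mean n x h \<le> (\<integral>u. g u * h u \<partial>lambda_pos)) \<longleftrightarrow> ?above"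
  proof
    assume *: "\<forall>h\<in>kmon_L2 k. sample_mean n x h \<le> (\<integral>u. g u * h u \<partial>lambda_pos)"
    show ?above
      using * dpow_kmon_L2[OF assms(1)] unfolding empirical_pairing_def pairing_def by blast
  next
    assume ?above
    then have "empirical_pairing (k - 1) n x t \<le> pairing (k - 1) g t" for t
      using neg by (cases "t < 0") auto
    then show "\<forall>h\<in>kmon_L2 k. sample_mean n x h \<le> (\<integral>u. g u * h u \<partial>lambda_pos)"
      using assms(1,8) pos by (intro ballI sample_mean_le_if_pairing_le) auto
  qed
  have contact: "(\<integral>u. (g u)\<^sup>2 \<partial>lambda_pos) = sample_mean n x g \<longleftrightarrow>
      (\<forall>t\<in>measure_supp F. pairing (k - 1) g t = empirical_pairing (k - 1) n x t)" if ?above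
  proof (rule square_integral_eq_sample_mean_iff[OF assms(1) pos assms(8,9)])
    show "empirical_pairing (k - 1) n x t \<le> pairing (k - 1) g t" for t
      using that neg by (cases "t < 0") auto
  qed
  have "is_lse k n x g \<longleftrightarrow> ?above \<and>
      (\<forall>t\<in>measure_supp F. pairing (k - 1) g t = empirical_pairing (k - 1) n x t)"
    using is_lse_iff_variational[of n x g k] assms(2,8) pos above contact by blast
  then show ?thesis unfolding x_def[abs_def, symmetric] H Y .
qed

end
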